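(* Assume that each $f_i:\mathbb{R}^n\to\mathbb{R}$, $i=1,\dots,N$, is continuously differentiable and strongly convex with $l$-Lipschitz continuous gradient; that the problem $\min\sum_{i=1}^N f_i(x_i)$ subject to $\sum_{i=1}^N x_i=\sum_{i=1}^N d_i$ has a finite optimal allocation $X^*$; that the attack signals $u_i^a(t),\lambda_i^a(t),z_i^a(t)\in\mathbb{R}^n$ and their time derivatives are bounded on $[0,\infty)$ for all $i$; and that $\frac{d}{dt}g_i(x_i(t))$ exists and is bounded for all $i$. Let $h_1,h_2:\mathbb{R}^{3n}\to\mathbb{R}^{3n}$ be functions for which there exist positive constants $l_1,\dots,l_5$ and positive definite, continuously differentiable functions $V_1,W_1:\mathbb{R}^{6n}\to\mathbb{R}$ such that for all $\eta=\mathrm{col}(\eta_1,\eta_2)$ with $\eta_1,\eta_2\in\mathbb{R}^{3n}$: 1) $l_1\|\eta\|^2\le V_1(\eta)\le l_2\|\eta\|^2$ and $l_3\|\eta\|^2\le W_1(\eta)\le l_4\|\eta\|^2$; 2) $\frac{\partial V_1}{\partial\eta_1}(\eta_2-h_1(\eta_1))-\frac{\partial V_1}{\partial\eta_2}h_2(\eta_1)\le -W_1(\eta)$; 3) $\left\|\frac{\partial V_1}{\partial\eta_2}\right\|\le l_5\|\eta\|$. Consider the resilient distributed resource allocation algorithm (described in the context) with the nonlinear extended state observer given by these $h_1,h_2$ and gains $a_1=w_0$, $a_2=w_0^2$, $w_0>0$. Then the algorithm converges to a small neighborhood of $X^*$ in the sense that $$\limsup_{t\to\infty}\|X(t)-X^*\|=O\!\left(\tfrac{1}{w_0}\right)\quad\text{as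 } w_0\to\infty,$$ that is, there are constants $C,\bar w>0$ independent of $w_0$ such that $\limsup_{t\to\infty}\|X(t)-X^*\|\le C/w_0$ for all $w_0\ge\bar w$.
   Context: $N$ agents have decisions $x_i\in\mathbb{R}^n$, cost functions $f_i$ and resource data $d_i\in\mathbb{R}^n$; $X=\mathrm{col}(x_1,\dots,x_N)$ is the stacked vector ($\mathrm{col}$ denotes stacking), and $\lambda_i,z_i\in\mathbb{R}^n$ are auxiliary states. Agent $i$ has dynamics $\dot x_i=g_i(x_i)+(\text{input})$ with $g_i:\mathbb{R}^n\to\mathbb{R}^n$ a (possibly unknown) nonlinear function. The communication graph on $\{1,\dots,N\}$ is fixed, undirected and connected, with symmetric weights $a_{ij}=a_{ji}\ge0$ ($a_{ij}>0$ exactly when $(i,j)$ is an edge). From the attack signals put $$\kappa_{i1}=u_i^a,\qquad \kappa_{i2}=-\sum_{j=1}^N a_{ij}(\lambda_i^a-\lambda_j^a)-\sum_{j=1}^N a_{ij}(z_i^a-z_j^a),\qquad \kappa_{i3}=\sum_{j=1}^N a_{ij}(\lambda_i^a-\lambda_j^a).$$ Let $\gamma_i=\mathrm{col}(x_i,\lambda_i,z_i)$ and $\kappa_i=\mathrm{col}(\kappa_{i1}+g_i(x_i),\kappa_{i2},\kappa_{i3})$ in $\mathbb{R}^{3n}$. Their estimates $\hat\gamma_i=\mathrm{col}(\hat x_i,\hat\lambda_i,\hat z_i)$ and $\hat\kappa_i=\mathrm{col}(\hat\kappa_{i1}+\hat g_i,\hat\kappa_{i2},\hat\kappa_{i3})$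 (the first block $\hat\kappa_{i1}+\hat g_i$ is a single $\mathbb{R}^n$-valued state) are generated by the extended state observer (ESO) $$\dot{\hat\gamma}_i=\hat\kappa_i+u_{io}+a_1h_1(\gamma_i-\hat\gamma_i),\qquad \dot{\hat\kappa}_i=a_2h_2(\gamma_i-\hat\gamma_i),$$ where $$u_{io}=\begin{bmatrix}-\nabla f_i(x_i)-\lambda_i-\hat\kappa_{i1}-\hat g_i\\ -\sum_{j} a_{ij}(\lambda_i-\lambda_j)-\sum_{j} a_{ij}(z_i-z_j)+x_i-d_i-\hat\kappa_{i2}\\ \sum_{j} a_{ij}(\lambda_i-\lambda_j)-\hat\kappa_{i3}\end{bmatrix}.$$ The resilient distributed resource allocation algorithm is the closed loop of this observer with $$\begin{aligned}\dot x_i&=g_i(x_i)-\nabla f_i(x_i)-\lambda_i+\kappa_{i1}-\hat\kappa_{i1}-\hat g_i,\\ \dot\lambda_i&=-\sum_{j} a_{ij}(\lambda_i-\lambda_j)-\sum_{j} a_{ij}(z_i-z_j)+x_i-d_i+\kappa_{i2}-\hat\kappa_{i2},\\ \dot z_i&=\sum_{j} a_{ij}(\lambda_i-\lambda_j)+\kappa_{i3}-\hat\kappa_{i3},\end{aligned}$$ i.e. $\dot\gamma_i=\kappa_i+u_{io}$. Solutions are considered on $[0,\infty)$, and the bound on $\frac{d}{dt}g_i(x_i(t))$ along solutions is understood to be independent of $w_0$. *)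

theory Defs
  imports "HOL-Analysis.Analysis"
begin

text \<open>
  Decisions live in \<open>real^'n\<close>; agents are the elements of a finite type \<open>'N\<close>.
  The spaces of dimension \<open>3n\<close> and \<open>6n\<close> are nested products, whose norm and inner
  product are the Euclidean ones of the stacked vector.
\<close>

type_synonym 'n vec3 = "(real^'n) \<times> (real^'n) \<times> (real^'n)"

definition C1_with_gradient :: "('v::real_inner \<Rightarrow> real) \<Rightarrow> ('v \<Rightarrow> 'v) \<Rightarrow> bool" where
  "C1_with_gradient F gradF \<longleftrightarrow>
     (\<forall>x. GDERIV F x :> gradF x) \<and> continuous_on UNIV gradF"

definition strongly_convex :: "('v::real_inner \<Rightarrow> real) \<Rightarrow> bool" where
  "strongly_convex F \<longleftrightarrow>
     (\<exists>\<mu>>0. \<forall>x y. \<forall>\<theta>\<in>{0..1}.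
        F (\<theta> *\<^sub>R x + (1 - \<theta>) *\<^sub>R y)
          \<le> \<theta> * F x + (1 - \<theta>) * F y - \<mu> / 2 * \<theta> * (1 - \<theta>) * (norm (x - y))\<^sup>2)"

definition positive_definite :: "('v::real_inner \<Rightarrow> real) \<Rightarrow> bool" where
  "positive_definite V \<longleftrightarrow> V 0 = 0 \<and> (\<forall>x. x \<noteq> 0 \<longrightarrow> V x > 0)"

definition connected_weights :: "('N \<Rightarrow> 'N \<Rightarrow> real) \<Rightarrow> bool" where
  "connected_weights a \<longleftrightarrow>
     (\<forall>i j. a i j = a j i) \<and> (\<forall>i j. 0 \<le> a i j) \<and>
     (\<forall>i j. (i, j) \<in> {(p, q). a p q > 0}\<^sup>*)"

definition optimal_allocation ::
    "('N::finite \<Rightarrow> real^'n \<Rightarrow> real) \<Rightarrow> ('N \<Rightarrow> real^'n) \<Rightarrow> (real^'n)^'N \<Rightarrow> bool" where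
  "optimal_allocation f d X \<longleftrightarrow>
     (\<Sum>i\<in>UNIV. X $ i) = (\<Sum>i\<in>UNIV. d i) \<and>
     (\<forall>Y. (\<Sum>i\<in>UNIV. Y $ i) = (\<Sum>i\<in>UNIV. d i) \<longrightarrow>
        (\<Sum>i\<in>UNIV. f i (X $ i)) \<le> (\<Sum>i\<in>UNIV. f i (Y $ i)))"

definition bounded_with_derivative :: "(real \<Rightarrow> 'v::real_normed_vector) \<Rightarrow> bool" where
  "bounded_with_derivative s \<longleftrightarrow>
     bounded (s ` {0..}) \<and>
     (\<exists>s'. (\<forall>t\<ge>0. (s has_vector_derivative s' t) (at t within {0..})) \<and> bounded (s' ` {0..}))"

definition derivative_bounded_by :: "real \<Rightarrow> (real \<Rightarrow> 'v::real_normed_vector) \<Rightarrow> bool" where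
  "derivative_bounded_by M s \<longleftrightarrow>
     (\<exists>s'. \<forall>t\<ge>0. (s has_vector_derivative s' t) (at t within {0..}) \<and> norm (s' t) \<le> M)"

text \<open>
  The two components of the gradient of \<open>V\<close> at \<open>(\<eta>1, \<eta>2)\<close> are the partial gradients with
  respect to \<open>\<eta>1\<close> and \<open>\<eta>2\<close>; a row vector applied to a column vector is an inner product.
\<close>

definition observer_condition ::
    "('n::finite vec3 \<Rightarrow> 'n vec3) \<Rightarrow> ('n vec3 \<Rightarrow> 'n vec3) \<Rightarrow> bool" where
  "observer_condition h1 h2 \<longleftrightarrow>
     (\<exists>l1 l2 l3 l4 l5 :: real. \<exists>V W :: 'n vec3 \<times> 'n vec3 \<Rightarrow> real. \<exists>gradV gradW.
        l1 > 0 \<and> l2 > 0 \<and> l3 > 0 \<and> l4 > 0 \<and> l5 > 0 \<and>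
        positive_definite V \<and> C1_with_gradient V gradV \<and>
        positive_definite W \<and> C1_with_gradient W gradW \<and>
        (\<forall>\<eta>1 \<eta>2.
           l1 * (norm (\<eta>1, \<eta>2))\<^sup>2 \<le> V (\<eta>1, \<eta>2) \<and> V (\<eta>1, \<eta>2) \<le> l2 * (norm (\<eta>1, \<eta>2))\<^sup>2 \<and>
           l3 * (norm (\<eta>1, \<eta>2))\<^sup>2 \<le> W (\<eta>1, \<eta>2) \<and> W (\<eta>1, \<eta>2) \<le> l4 * (norm (\<eta>1, \<eta>2))\<^sup>2 \<and>
           fst (gradV (\<eta>1, \<eta>2)) \<bullet> (\<eta>2 - h1 \<eta>1) - snd (gradV (\<eta>1, \<eta>2)) \<bullet> h2 \<eta>1
             \<le> - W (\<eta>1, \<eta>2) \<and>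
           norm (snd (gradV (\<eta>1, \<eta>2))) \<le> l5 * norm (\<eta>1, \<eta>2)))"

abbreviation block1 :: "'n vec3 \<Rightarrow> real^'n" where "block1 v \<equiv> fst v"
abbreviation block2 :: "'n vec3 \<Rightarrow> real^'n" where "block2 v \<equiv> fst (snd v)"
abbreviation block3 :: "'n vec3 \<Rightarrow> real^'n" where "block3 v \<equiv> snd (snd v)"

definition disagreement ::
    "('N::finite \<Rightarrow> 'N \<Rightarrow> real) \<Rightarrow> ('N \<Rightarrow> real^'n) \<Rightarrow> 'N \<Rightarrow> real^'n" where
  "disagreement a v i = (\<Sum>j\<in>UNIV. a i j *\<^sub>R (v i - v j))"

text \<open>
  \<open>disturbance\<close> is \<open>col(\<kappa>1 + g(x), \<kappa>2, \<kappa>3)\<close> of agent \<open>i\<close>, where the attack values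
  \<open>ua, la, za\<close> and the decision \<open>x\<close> are those at the current time.
\<close>

definition disturbance ::
    "('N::finite \<Rightarrow> 'N \<Rightarrow> real) \<Rightarrow> ('N \<Rightarrow> real^'n \<Rightarrow> real^'n) \<Rightarrow>
     ('N \<Rightarrow> real^'n) \<Rightarrow> ('N \<Rightarrow> real^'n) \<Rightarrow> ('N \<Rightarrow> real^'n) \<Rightarrow> ('N \<Rightarrow> real^'n) \<Rightarrow> 'N \<Rightarrow> 'n vec3" where
  "disturbance a g ua la za x i =
     (ua i + g i (x i),
      - disagreement a la i - disagreement a za i,
      disagreement a la i)"

definition observer_input ::
    "('N::finite \<Rightarrow> 'N \<Rightarrow> real) \<Rightarrow> ('N \<Rightarrow> real^'n \<Rightarrow> real^'n) \<Rightarrow> ('N \<Rightarrow> real^'n) \<Rightarrow>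
     ('N \<Rightarrow> real^'n) \<Rightarrow> ('N \<Rightarrow> real^'n) \<Rightarrow> ('N \<Rightarrow> real^'n) \<Rightarrow> ('N \<Rightarrow> 'n vec3) \<Rightarrow> 'N \<Rightarrow> 'n vec3" where
  "observer_input a gradf d x lam z kaph i =
     (- gradf i (x i) - lam i - block1 (kaph i),
      - disagreement a lam i - disagreement a z i + x i - d i - block2 (kaph i),
      disagreement a lam i - block3 (kaph i))"

text \<open>
  Closed loop of algorithm and observer, for the states \<open>gam = col(x, \<lambda>, z)\<close>, its estimate
  \<open>gamh\<close>, and the estimate \<open>kaph\<close> of the disturbance. The first block of \<open>kaph\<close> is the single
  state estimating \<open>\<kappa>1 + g(x)\<close>.
\<close>

definition closed_loop_solution ::
    "('N::finite \<Rightarrow> 'N \<Rightarrow> real) \<Rightarrow> ('N \<Rightarrow> real^'n \<Rightarrow> real^'n) \<Rightarrow> ('N \<Rightarrow> real^'n) \<Rightarrow>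
     ('N \<Rightarrow> real^'n \<Rightarrow> real^'n) \<Rightarrow>
     ('N \<Rightarrow> real \<Rightarrow> real^'n) \<Rightarrow> ('N \<Rightarrow> real \<Rightarrow> real^'n) \<Rightarrow> ('N \<Rightarrow> real \<Rightarrow> real^'n) \<Rightarrow>
     ('n vec3 \<Rightarrow> 'n vec3) \<Rightarrow> ('n vec3 \<Rightarrow> 'n vec3) \<Rightarrow> real \<Rightarrow> real \<Rightarrow>
     ('N \<Rightarrow> real \<Rightarrow> 'n vec3) \<Rightarrow> ('N \<Rightarrow> real \<Rightarrow> 'n vec3) \<Rightarrow> ('N \<Rightarrow> real \<Rightarrow> 'n vec3) \<Rightarrow> bool" where
  "closed_loop_solution a gradf d g ua la za h1 h2 a1 a2 gam gamh kaph \<longleftrightarrow>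
     (\<forall>i. \<forall>t\<ge>0.
        let kap = disturbance a g (\<lambda>j. ua j t) (\<lambda>j. la j t) (\<lambda>j. za j t)
                    (\<lambda>j. block1 (gam j t)) i;
            u = observer_input a gradf d (\<lambda>j. block1 (gam j t)) (\<lambda>j. block2 (gam j t))
                    (\<lambda>j. block3 (gam j t)) (\<lambda>j. kaph j t) i
        in (gam i has_vector_derivative (kap + u)) (at t within {0..}) \<and>
           (gamh i has_vector_derivative (kaph i t + u + a1 *\<^sub>R h1 (gam i t - gamh i t)))
             (at t within {0..}) \<and>
           (kaph i has_vector_derivative (a2 *\<^sub>R h2 (gam i t - gamh i t))) (at t within {0..}))"

end

theory Submission imports Defs begin

text \<open>
  With \<open>\<eta> = (\<gamma> - \<gamma>h, (\<kappa> - \<kappa>h) / w0)\<close> the observer error obeys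
  \<open>\<eta>' = w0 (\<eta>2 - h1 \<eta>1, - h2 \<eta>1) + (0, \<kappa>' / w0)\<close>, so the given Lyapunov function yields
  \<open>limsup |\<eta>| = O(1 / w0^2)\<close>, that is \<open>limsup |\<kappa> - \<kappa>h| = O(1 / w0)\<close>.
  The remaining states then follow the primal-dual flow perturbed by \<open>\<kappa> - \<kappa>h\<close>. Around a
  saddle point, and with the uncontrolled mean of \<open>z\<close> removed, this flow is input-to-state stable:
  the quadratic energy alone does not dissipate \<open>\<lambda>\<close> and \<open>z\<close>, but adding the small cross terms
  \<open>\<epsilon> x \<bullet> \<lambda> + \<epsilon>' \<lambda> \<bullet> L z\<close> with \<open>\<epsilon>'\<close> much smaller than \<open>\<epsilon>\<close> repairs this.
\<close>

section \<open>Scalar comparison inequalities\<close>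

text \<open>Integrating factor: the decay inequality makes
  \<open>(u - \<beta> / \<alpha>) * exp (\<alpha> * t)\<close> nonincreasing, so the excess of
  \<open>u\<close> over \<open>\<beta> / \<alpha>\<close> is dominated by a decaying exponential.
  The strict inequality on \<open>c\<close> turns this limiting bound into one that holds from some
  time on.\<close>

lemma eventually_le_of_linear_decay:
  fixes u u' :: "real \<Rightarrow> real"
  assumes \<alpha>: "\<alpha> > 0" and c: "\<beta> / \<alpha> < c"
    and der: "\<And>t. t \<ge> T \<Longrightarrow> (u has_real_derivative u' t) (at t)"
    and decay: "\<And>t. t \<ge> T \<Longrightarrow> u' t \<le> - \<alpha> * u t + \<beta>"
  shows "eventually (\<lambda>t. u t \<le> c) at_top"
proof -
  define v where "v t = (u t - \<beta> / \<alpha>) * exp (\<alpha> * t)" for t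
  have v_mono: "v t \<le> v T" if "t \<ge> T" for t
  proof (rule DERIV_nonpos_imp_nonincreasing[OF that])
    fix s assume s: "T \<le> s"
    have "(v has_real_derivative (u' s + \<alpha> * u s - \<beta>) * exp (\<alpha> * s)) (at s)"
      unfolding v_def using \<alpha>
      by (auto intro!: derivative_eq_intros der s simp: field_simps)
    moreover have "(u' s + \<alpha> * u s - \<beta>) * exp (\<alpha> * s) \<le> 0"
      using decay[OF s] by (intro mult_nonpos_nonneg) auto
    ultimately show "\<exists>y. (v has_real_derivative y) (at s) \<and> y \<le> 0" by blast
  qed
  have le: "u t \<le> \<beta> / \<alpha> + v T * exp (- (\<alpha> * t))" if "t \<ge> T" for t
    using v_mono[OF that] unfolding v_def by (simp add: exp_minus field_simps)
  have "filterlim (\<lambda>t. \<alpha> * t) at_top at_top"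
    using \<alpha> by (intro filterlim_tendsto_pos_mult_at_top[OF tendsto_const]) (auto simp: filterlim_ident)
  then have "((\<lambda>t. exp (- (\<alpha> * t))) \<longlongrightarrow> 0) at_top"
    by (intro filterlim_compose[OF exp_at_bot]) (simp add: filterlim_uminus_at_bot)
  then have "((\<lambda>t. \<beta> / \<alpha> + v T * exp (- (\<alpha> * t))) \<longlongrightarrow> \<beta> / \<alpha> + v T * 0) at_top"
    by (intro tendsto_intros)
  then have "eventually (\<lambda>t. \<beta> / \<alpha> + v T * exp (- (\<alpha> * t)) < c) at_top"
    using c by (intro order_tendstoD(2)) auto
  then show ?thesis
    using eventually_ge_at_top[of T] by eventually_elim (use le in force)
qed

text \<open>The square of \<open>2 * s * a - b\<close> divided by \<open>4 * s\<close>. The weight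
  \<open>s\<close> stays free so that each use can fix which share of a dissipation term the first
  square consumes.\<close>

lemma young:
  fixes a b s :: real
  assumes "s > 0"
  shows "a * b \<le> s * a\<^sup>2 + b\<^sup>2 / (4 * s)"
proof -
  have "0 \<le> (2 * s * a - b)\<^sup>2 / (4 * s)" using assms by simp
  also have "\<dots> = s * a\<^sup>2 + b\<^sup>2 / (4 * s) - a * b"
    using assms by (simp add: power2_eq_square field_simps)
  finally show ?thesis by simp
qed

subsection \<open>Strong convexity and optimality\<close>

text \<open>The slack \<open>\<psi>\<close> of the strong convexity inequality along the segment
  from \<open>y\<close> to \<open>x\<close> is nonnegative on the unit interval and vanishes at 0.
  Its derivative there is the gap \<open>D'\<close> between the two sides of the claim, so a
  negative gap would push the slack below zero just to the right of 0.\<close>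

lemma strongly_convex_gradient_ge:
  assumes sc: "\<forall>x y. \<forall>\<theta>\<in>{0..1}. F (\<theta> *\<^sub>R x + (1 - \<theta>) *\<^sub>R y)
          \<le> \<theta> * F x + (1 - \<theta>) * F y - \<mu> / 2 * \<theta> * (1 - \<theta>) * (norm (x - y))\<^sup>2"
    and grad: "GDERIV F y :> D"
  shows "(x - y) \<bullet> D \<le> F x - F y - \<mu> / 2 * (norm (x - y))\<^sup>2"
proof (rule ccontr)
  define \<psi> where "\<psi> \<theta> = \<theta> * (F x - F y) - \<mu> / 2 * \<theta> * (1 - \<theta>) * (norm (x - y))\<^sup>2
    - (F (y + \<theta> *\<^sub>R (x - y)) - F y)" for \<theta>
  define D' where "D' = F x - F y - \<mu> / 2 * (norm (x - y))\<^sup>2 - (x - y) \<bullet> D"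
  assume "\<not> ?thesis"
  then have neg: "D' < 0" by (simp add: D'_def)
  have "((\<lambda>\<theta>. y + \<theta> *\<^sub>R (x - y)) has_derivative (\<lambda>h. h *\<^sub>R (x - y))) (at 0)"
    by (auto intro!: derivative_eq_intros)
  moreover have "(F has_derivative (\<lambda>h. h \<bullet> D)) (at (y + 0 *\<^sub>R (x - y)))"
    using grad by (simp add: gderiv_def)
  ultimately have "((\<lambda>\<theta>. F (y + \<theta> *\<^sub>R (x - y))) has_derivative (\<lambda>h. (h *\<^sub>R (x - y)) \<bullet> D)) (at 0)"
    by (rule has_derivative_compose)
  then have "((\<lambda>\<theta>. F (y + \<theta> *\<^sub>R (x - y))) has_real_derivative ((x - y) \<bullet> D)) (at 0)"
    by (simp add: has_field_derivative_def mult.commute[of _ "(x - y) \<bullet> D"])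
  then have "(\<psi> has_real_derivative D') (at 0)"
    unfolding \<psi>_def D'_def by (auto intro!: derivative_eq_intros simp: algebra_simps)
  from DERIV_neg_dec_right[OF this neg] obtain \<delta> where
    \<delta>: "\<delta> > 0" "\<And>h. 0 < h \<Longrightarrow> h < \<delta> \<Longrightarrow> \<psi> h < \<psi> 0" by auto
  \<comment> \<open>Capped at 1 because strong convexity speaks only of weights in the unit
    interval.\<close>
  define h where "h = min (\<delta> / 2) 1"
  have h: "0 < h" "h < \<delta>" "h \<in> {0..1}" using \<delta>(1) by (auto simp: h_def)
  have "h *\<^sub>R x + (1 - h) *\<^sub>R y = y + h *\<^sub>R (x - y)" by (simp add: algebra_simps)
  with sc[rule_format, OF h(3), of x y] have "\<psi> h \<ge> 0"
    by (simp add: \<psi>_def algebra_simps)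
  moreover have "\<psi> 0 = 0" by (simp add: \<psi>_def)
  ultimately show False using \<delta>(2)[OF h(1,2)] by simp
qed

text \<open>Add the gradient inequality for \<open>x\<close>, \<open>y\<close> to the one with the
  roles exchanged: the function values cancel and the two halves of \<open>\<mu>\<close> add
  up.\<close>

lemma strongly_convex_strongly_monotone:
  assumes "strongly_convex F" and "\<And>x. GDERIV F x :> gradF x"
  obtains \<mu> where "\<mu> > 0"
    "\<And>x y. \<mu> * (norm (x - y))\<^sup>2 \<le> (gradF x - gradF y) \<bullet> (x - y)"
proof -
  from assms(1) obtain \<mu> where \<mu>: "\<mu> > 0" and
    sc: "\<forall>x y. \<forall>\<theta>\<in>{0..1}. F (\<theta> *\<^sub>R x + (1 - \<theta>) *\<^sub>R y)
          \<le> \<theta> * F x + (1 - \<theta>) * F y - \<mu> / 2 * \<theta> * (1 - \<theta>) * (norm (x - y))\<^sup>2"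
    unfolding strongly_convex_def by blast
  have "\<mu> * (norm (x - y))\<^sup>2 \<le> (gradF x - gradF y) \<bullet> (x - y)" for x y
    using strongly_convex_gradient_ge[OF sc assms(2), of x y]
      strongly_convex_gradient_ge[OF sc assms(2), of y x]
    by (simp add: norm_minus_commute inner_diff_left inner_diff_right inner_commute)
  with \<mu> show ?thesis by (rule that)
qed

text \<open>First-order optimality: shifting resource from agent \<open>j\<close> to agent
  \<open>i\<close> keeps the allocation feasible, so the derivative of the total cost in that
  direction vanishes. For the shift \<open>v\<close> equal to the difference of the two gradients,
  this derivative is \<open>v \<bullet> v\<close>.\<close>

lemma optimal_allocation_gradients_eq:
  fixes f :: "'N::finite \<Rightarrow> real^'n \<Rightarrow> real"
  assumes opt: "optimal_allocation f d X"
    and grad: "\<And>i x. GDERIV (f i) x :> gradf i x"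
  shows "gradf i (X $ i) = gradf j (X $ j)"
proof -
  define v where "v = gradf i (X $ i) - gradf j (X $ j)"
  define w :: "(real^'n)^'N" where "w = axis i v - axis j v"
  have sum_axis: "(\<Sum>k\<in>UNIV. axis m v $ k) = v" for m :: 'N
    by (simp add: axis_def)
  have "(\<Sum>k\<in>UNIV. w $ k) = 0" by (simp add: w_def sum_subtractf sum_axis)
  then have feas: "(\<Sum>k\<in>UNIV. (X + t *\<^sub>R w) $ k) = (\<Sum>k\<in>UNIV. d k)" for t
    using opt by (simp add: optimal_allocation_def sum.distrib flip: scaleR_sum_right)
  define \<phi> where "\<phi> t = (\<Sum>k\<in>UNIV. f k (X $ k + t *\<^sub>R w $ k))" for t
  have min: "\<phi> 0 \<le> \<phi> t" for t
  proof -
    have "(\<Sum>k\<in>UNIV. f k (X $ k)) \<le> (\<Sum>k\<in>UNIV. f k ((X + t *\<^sub>R w) $ k))"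
      using opt feas[of t] unfolding optimal_allocation_def by blast
    then show ?thesis by (simp add: \<phi>_def)
  qed
  have "((\<lambda>t. f k (X $ k + t *\<^sub>R w $ k)) has_derivative (\<lambda>h. (h *\<^sub>R w $ k) \<bullet> gradf k (X $ k))) (at 0)" for k
  proof (rule has_derivative_compose[where f="\<lambda>t. X $ k + t *\<^sub>R w $ k"])
    show "((\<lambda>t. X $ k + t *\<^sub>R w $ k) has_derivative (\<lambda>h. h *\<^sub>R w $ k)) (at 0)"
      by (auto intro!: derivative_eq_intros)
    show "(f k has_derivative (\<lambda>h. h \<bullet> gradf k (X $ k))) (at (X $ k + 0 *\<^sub>R w $ k))"
      using grad by (simp add: gderiv_def)
  qed
  then have "(\<phi> has_derivative (\<lambda>h. \<Sum>k\<in>UNIV. (h *\<^sub>R w $ k) \<bullet> gradf k (X $ k))) (at 0)"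
    unfolding \<phi>_def by (intro has_derivative_sum)
  also have "(\<lambda>h. \<Sum>k\<in>UNIV. (h *\<^sub>R w $ k) \<bullet> gradf k (X $ k))
      = (*) (w \<bullet> (\<chi> k. gradf k (X $ k)))"
    by (simp add: inner_vec_def[of w] fun_eq_iff sum_distrib_left mult.commute)
  finally have "(\<phi> has_real_derivative (w \<bullet> (\<chi> k. gradf k (X $ k)))) (at 0)"
    by (simp add: has_field_derivative_def)
  from DERIV_local_min[OF this, of 1] min have "w \<bullet> (\<chi> k. gradf k (X $ k)) = 0" by simp
  then have "v \<bullet> v = 0"
    by (simp add: w_def inner_diff_left inner_axis' inner_diff_right v_def)
  then show ?thesis by (simp add: v_def)
qed

subsection \<open>Perturbed saddle flow\<close>

text \<open>The arguments \<open>x\<close>, \<open>y\<close>, \<open>z\<close> stand for the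
  deviations of the decisions, of the multipliers and of the centered auxiliary states from the
  saddle point. The weight \<open>\<kappa>\<close> is the small factor written
  \<open>\<epsilon>'\<close> in the overview and is unrelated to the disturbance of the same
  name.\<close>

definition saddle_energy :: "('v::real_inner \<Rightarrow> 'v) \<Rightarrow> real \<Rightarrow> real \<Rightarrow> 'v \<Rightarrow> 'v \<Rightarrow> 'v \<Rightarrow> real" where
  "saddle_energy L \<epsilon> \<kappa> x y z =
     ((norm x)\<^sup>2 + (norm y)\<^sup>2 + (norm z)\<^sup>2) / 2 + \<epsilon> * (x \<bullet> y) + \<kappa> * (y \<bullet> L z)"

text \<open>The formal time derivative of \<open>saddle_energy\<close>. Taking the velocities as
  arguments makes the decay estimate a pointwise algebraic inequality, free of trajectories.\<close>

definition saddle_rate ::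
    "('v::real_inner \<Rightarrow> 'v) \<Rightarrow> real \<Rightarrow> real \<Rightarrow> 'v \<Rightarrow> 'v \<Rightarrow> 'v \<Rightarrow> 'v \<Rightarrow> 'v \<Rightarrow> 'v \<Rightarrow> real" where
  "saddle_rate L \<epsilon> \<kappa> x y z x' y' z' =
     x \<bullet> x' + y \<bullet> y' + z \<bullet> z' + \<epsilon> * (x' \<bullet> y + x \<bullet> y') + \<kappa> * (y' \<bullet> L z + y \<bullet> L z')"

lemma saddle_energy_has_derivative:
  assumes "bounded_linear L" and "(x has_vector_derivative x') (at t)"
    "(y has_vector_derivative y') (at t)" "(z has_vector_derivative z') (at t)"
  shows "((\<lambda>t. saddle_energy L \<epsilon> \<kappa> (x t) (y t) (z t))
           has_real_derivative saddle_rate L \<epsilon> \<kappa> (x t) (y t) (z t) x' y' z') (at t)"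
proof -
  note d = assms(2-4)[unfolded has_vector_derivative_def]
  note Lz = bounded_linear.has_derivative[OF assms(1) d(3)]
  interpret bounded_linear L by fact
  have norm_sq: "((\<lambda>t. (norm (u t))\<^sup>2) has_real_derivative 2 * (u t \<bullet> u')) (at t)"
    if "(u has_vector_derivative u') (at t)" for u :: "real \<Rightarrow> 'a" and u'
    using has_derivative_inner[OF that[unfolded has_vector_derivative_def] that[unfolded has_vector_derivative_def]]
    unfolding has_field_derivative_def power2_norm_eq_inner
    by (rule has_derivative_eq_rhs) (simp add: fun_eq_iff inner_commute)
  have inn: "((\<lambda>t. u t \<bullet> v t) has_real_derivative u' \<bullet> v t + u t \<bullet> v') (at t)"
    if "(u has_vector_derivative u') (at t)" "(v has_vector_derivative v') (at t)"
    for u v :: "real \<Rightarrow> 'a" and u' v'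
    using has_derivative_inner[OF that[unfolded has_vector_derivative_def]]
    unfolding has_field_derivative_def
    by (rule has_derivative_eq_rhs) (simp add: fun_eq_iff algebra_simps)
  have "((\<lambda>t. L (z t)) has_vector_derivative L z') (at t)"
    using Lz by (simp add: has_vector_derivative_def scaleR)
  then have "((\<lambda>t. saddle_energy L \<epsilon> \<kappa> (x t) (y t) (z t)) has_real_derivative
      (2 * (x t \<bullet> x') + 2 * (y t \<bullet> y') + 2 * (z t \<bullet> z')) / 2 + \<epsilon> * (x' \<bullet> y t + x t \<bullet> y')
      + \<kappa> * (y' \<bullet> L (z t) + y t \<bullet> L z')) (at t)"
    unfolding saddle_energy_def
    by (intro DERIV_add DERIV_cdivide DERIV_cmult norm_sq inn assms)
  then show ?thesis by (simp add: saddle_rate_def add_divide_distrib)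
qed

text \<open>Each cross term costs at most one eighth of the two squares that it couples. Together
  they take at most a quarter of the sum of squares, which is half of the quadratic part.\<close>

lemma saddle_energy_bounds:
  assumes K: "\<And>u. norm (L u) \<le> K * norm u"
    and \<epsilon>: "0 \<le> \<epsilon>" "\<epsilon> \<le> 1/4" and \<kappa>: "0 \<le> \<kappa>" "\<kappa> * K \<le> 1/4"
  shows "((norm x)\<^sup>2 + (norm y)\<^sup>2 + (norm z)\<^sup>2) / 4 \<le> saddle_energy L \<epsilon> \<kappa> x y z"
    and "saddle_energy L \<epsilon> \<kappa> x y z \<le> (norm x)\<^sup>2 + (norm y)\<^sup>2 + (norm z)\<^sup>2"
proof -
  have yg: "2 * (a * b) \<le> a\<^sup>2 + b\<^sup>2" for a b :: real
    using zero_le_power2[of "a - b"] by (simp add: power2_diff)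
  have "\<bar>\<epsilon> * (x \<bullet> y)\<bar> \<le> 1/4 * (norm x * norm y)"
    unfolding abs_mult using \<epsilon> by (intro mult_mono Cauchy_Schwarz_ineq2) auto
  also have "\<dots> \<le> ((norm x)\<^sup>2 + (norm y)\<^sup>2) / 8" using yg[of "norm x" "norm y"] by simp
  finally have 1: "\<bar>\<epsilon> * (x \<bullet> y)\<bar> \<le> ((norm x)\<^sup>2 + (norm y)\<^sup>2) / 8" .
  have "\<bar>y \<bullet> L z\<bar> \<le> norm y * (K * norm z)"
    by (rule order_trans[OF Cauchy_Schwarz_ineq2]) (intro mult_left_mono K norm_ge_zero)
  then have "\<bar>\<kappa> * (y \<bullet> L z)\<bar> \<le> \<kappa> * (norm y * (K * norm z))"
    using \<kappa> by (auto simp: abs_mult intro!: mult_left_mono)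
  also have "\<dots> = (\<kappa> * K) * (norm y * norm z)" by simp
  also have "\<dots> \<le> 1/4 * (norm y * norm z)" using \<kappa> by (intro mult_right_mono) auto
  also have "\<dots> \<le> ((norm y)\<^sup>2 + (norm z)\<^sup>2) / 8" using yg[of "norm y" "norm z"] by simp
  finally have 2: "\<bar>\<kappa> * (y \<bullet> L z)\<bar> \<le> ((norm y)\<^sup>2 + (norm z)\<^sup>2) / 8" .
  have "0 \<le> (norm x)\<^sup>2" "0 \<le> (norm y)\<^sup>2" "0 \<le> (norm z)\<^sup>2" by simp_all
  with abs_le_D1[OF 1] abs_le_D2[OF 1] abs_le_D1[OF 2] abs_le_D2[OF 2]
  show "((norm x)\<^sup>2 + (norm y)\<^sup>2 + (norm z)\<^sup>2) / 4 \<le> saddle_energy L \<epsilon> \<kappa> x y z"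
    and "saddle_energy L \<epsilon> \<kappa> x y z \<le> (norm x)\<^sup>2 + (norm y)\<^sup>2 + (norm z)\<^sup>2"
    unfolding saddle_energy_def add_divide_distrib by - linarith+
qed

text \<open>
  The factors 8 and 74 are chosen so that, after Young's inequality, the mixed terms consume at
  most half of each of the dissipation terms \<open>\<mu> |x|\<^sup>2\<close>, \<open>\<epsilon> |y|\<^sup>2\<close>, \<open>\<kappa> |L z|\<^sup>2\<close>.
\<close>

lemma saddle_rate_le:
  fixes L :: "'v::real_inner \<Rightarrow> 'v"
  assumes L: "bounded_linear L" and sym: "\<And>u v. L u \<bullet> v = u \<bullet> L v" and psd: "\<And>u. 0 \<le> u \<bullet> L u"
    and K: "1 \<le> K" "\<And>u. norm (L u) \<le> K * norm u"
    and e: "e > 0" "e * norm z \<le> norm (L z)"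
    and \<mu>: "\<mu> > 0" "\<mu> * (norm x)\<^sup>2 \<le> x \<bullet> G" and G: "norm G \<le> K * norm x"
    and \<epsilon>: "0 < \<epsilon>" "\<epsilon> \<le> 1/4" "74 * K\<^sup>2 * \<epsilon> \<le> \<mu>" and \<kappa>: "8 * K\<^sup>2 * \<kappa> = \<epsilon>"
  shows "saddle_rate L \<epsilon> \<kappa> x y z (- G - y + p) (- L y - L z + x + q) (L y + r)
    \<le> - min (\<mu> / 4) (min (\<epsilon> / 4) (\<kappa> * e\<^sup>2 / 4)) * ((norm x)\<^sup>2 + (norm y)\<^sup>2 + (norm z)\<^sup>2)
      + (2 / \<mu> + 3 / \<epsilon> + 2 / \<kappa> + 2 / (\<kappa> * e\<^sup>2)) * ((norm p)\<^sup>2 + (norm q)\<^sup>2 + (norm r)\<^sup>2)"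
proof -
  interpret bounded_linear L by fact
  define X Y Z W P Q R where n: "X = norm x" "Y = norm y" "Z = norm z" "W = norm (L z)"
    "P = norm p" "Q = norm q" "R = norm r"
  have nn: "0 \<le> X" "0 \<le> Y" "0 \<le> Z" "0 \<le> W" "0 \<le> P" "0 \<le> Q" "0 \<le> R" by (simp_all add: n)
  have K2: "1 \<le> K\<^sup>2" "K \<le> K\<^sup>2" using K(1) mult_mono[of 1 K 1 K] mult_left_mono[of 1 K K]
    by (simp_all add: power2_eq_square)
  have \<kappa>0: "\<kappa> > 0" using \<epsilon>(1) \<kappa> K2 by (smt (verit) zero_less_mult_iff)
  have \<kappa>\<epsilon>: "\<kappa> \<le> \<epsilon>" using mult_right_mono[OF K2(1), of \<kappa>] \<kappa> \<kappa>0 by linarith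
  have \<kappa>K: "\<kappa> * K \<le> 1" 
  proof -
    have "\<kappa> * K \<le> \<kappa> * K\<^sup>2" using K2 \<kappa>0 by simp
    moreover have "\<kappa> * K\<^sup>2 = \<epsilon> / 8" using \<kappa> by (simp add: mult.commute mult.left_commute)
    ultimately show ?thesis using \<epsilon>(2) by linarith
  qed
  have cs: "u \<bullet> v \<le> norm u * norm v" "- (u \<bullet> v) \<le> norm u * norm v" for u v :: 'v
    using norm_cauchy_schwarz[of u v] norm_cauchy_schwarz[of "-u" v] by simp_all
  have Ky: "norm (L y) \<le> K * Y" and Kr: "norm (L r) \<le> K * R"
    using K(2)[of y] K(2)[of r] by (simp_all add: n)
  have KLy: "norm (L (L y)) \<le> K * (K * Y)"
    using order_trans[OF K(2)[of "L y"] mult_left_mono[OF Ky, of K]] K(1) by simp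
  have GK: "norm G \<le> K * X" using G by (simp add: n)

  \<comment> \<open>The skew couplings cancel: \<open>x \<bullet> y\<close> directly, and
    \<open>y \<bullet> L z\<close> against \<open>z \<bullet> L y\<close> by symmetry. The cross
    terms contribute the missing dissipation \<open>- \<epsilon> * Y\<^sup>2\<close> and
    \<open>- \<kappa> * W\<^sup>2\<close>.\<close>
  have rate: "saddle_rate L \<epsilon> \<kappa> x y z (- G - y + p) (- L y - L z + x + q) (L y + r)
     = - (x \<bullet> G) + x \<bullet> p - y \<bullet> L y + y \<bullet> q + z \<bullet> r
     + \<epsilon> * (- (G \<bullet> y) - Y\<^sup>2 + p \<bullet> y - (x \<bullet> L y) - (x \<bullet> L z) + X\<^sup>2 + x \<bullet> q)
     + \<kappa> * (- (L y \<bullet> L z) - W\<^sup>2 + x \<bullet> L z + q \<bullet> L z + y \<bullet> L (L y) + y \<bullet> L r)"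
    unfolding saddle_rate_def n power2_norm_eq_inner
    using sym[of z y] 
    by (simp add: inner_add_left inner_add_right inner_diff_left inner_diff_right add inner_commute algebra_simps)

  have A: "- (G \<bullet> y) - Y\<^sup>2 + p \<bullet> y - (x \<bullet> L y) - (x \<bullet> L z) + X\<^sup>2 + x \<bullet> q
     \<le> K * X * Y - Y\<^sup>2 + P * Y + X * (K * Y) + X * W + X\<^sup>2 + X * Q"
    using cs(2)[of G y] cs(1)[of p y] cs(2)[of x "L y"] cs(2)[of x "L z"] cs(1)[of x q]
      mult_right_mono[OF GK, of Y] mult_left_mono[OF Ky, of X] nn
    unfolding n[symmetric] by linarith
  have B: "- (L y \<bullet> L z) - W\<^sup>2 + x \<bullet> L z + q \<bullet> L z + y \<bullet> L (L y) + y \<bullet> L r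
     \<le> K * Y * W - W\<^sup>2 + X * W + Q * W + Y * (K * (K * Y)) + Y * (K * R)"
    using cs(2)[of "L y" "L z"] cs(1)[of x "L z"] cs(1)[of q "L z"] cs(1)[of y "L (L y)"] cs(1)[of y "L r"]
      mult_right_mono[OF Ky, of W] mult_left_mono[OF KLy, of Y] mult_left_mono[OF Kr, of Y] nn
    unfolding n[symmetric] by linarith
  \<comment> \<open>Dissipation is available for \<open>W\<close>, the norm of \<open>L z\<close>,
    and not for \<open>Z\<close>; coercivity converts the only term that contains
    \<open>Z\<close>.\<close>
  have ZR: "Z * R \<le> W * (R / e)"
    using mult_right_mono[OF e(2), of R] nn e(1) unfolding n[symmetric] by (simp add: field_simps)

  have y1: "\<epsilon> * (K * X * Y + X * (K * Y)) \<le> \<epsilon> * (4 * K\<^sup>2 * X\<^sup>2 + Y\<^sup>2 / 4)"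
    using young[of 1 "2 * K * X" Y] \<epsilon>(1) by (intro mult_left_mono) (auto simp: power_mult_distrib)
  \<comment> \<open>The coupling has size \<open>\<epsilon>\<close> while \<open>W\<close>
    dissipates only at the smaller rate \<open>\<kappa>\<close>. The relation between the two
    weights lets the surplus be paid by \<open>X\<close>, whose rate \<open>\<mu>\<close> is not
    small.\<close>
  have y2: "(\<epsilon> + \<kappa>) * (X * W) \<le> 32 * K\<^sup>2 * \<epsilon> * X\<^sup>2 + \<kappa> * W\<^sup>2 / 4"
  proof -
    have "(\<epsilon> + \<kappa>) * (X * W) \<le> (2 * \<epsilon>) * (X * W)" using \<kappa>\<epsilon> nn by (intro mult_right_mono) auto
    also have "\<dots> = \<kappa> * (W * (16 * K\<^sup>2 * X))" by (subst \<kappa>[symmetric]) simp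
    also have "\<dots> \<le> \<kappa> * (1/4 * W\<^sup>2 + (16 * K\<^sup>2 * X)\<^sup>2 / (4 * (1/4)))"
      using \<kappa>0 by (intro mult_left_mono young) auto
    also have "\<dots> = 32 * K\<^sup>2 * \<epsilon> * X\<^sup>2 + \<kappa> * W\<^sup>2 / 4"
      by (subst \<kappa>[symmetric]) (simp add: power2_eq_square algebra_simps)
    finally show ?thesis .
  qed
  \<comment> \<open>Here the factor 8 enters: \<open>2 * K\<^sup>2 * \<kappa>\<close> is exactly
    \<open>\<epsilon> / 4\<close>.\<close>
  have y3: "\<kappa> * (K * Y * W + Y * (K * (K * Y))) \<le> \<epsilon> * Y\<^sup>2 / 4 + \<kappa> * W\<^sup>2 / 4"
  proof -
    have "K * Y * W + Y * (K * (K * Y)) \<le> 2 * K\<^sup>2 * Y\<^sup>2 + W\<^sup>2 / 4"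
      using young[of 1 "K * Y" W] by (simp add: power2_eq_square algebra_simps)
    then have "\<kappa> * (K * Y * W + Y * (K * (K * Y))) \<le> \<kappa> * (2 * K\<^sup>2 * Y\<^sup>2 + W\<^sup>2 / 4)"
      using \<kappa>0 by (intro mult_left_mono) auto
    also have "\<dots> = \<epsilon> * Y\<^sup>2 / 4 + \<kappa> * W\<^sup>2 / 4" by (subst \<kappa>[symmetric]) (simp add: algebra_simps)
    finally show ?thesis .
  qed
  have shrink: "c * b \<le> b" if "c \<le> 1" "0 \<le> b" for c b :: real
    using mult_right_mono[OF that] by simp
  \<comment> \<open>The disturbance terms spend half of what the mixed terms leave: two shares of
    \<open>\<mu> / 8\<close>, three of \<open>\<epsilon> / 12\<close> and two of
    \<open>\<kappa> / 8\<close>. Prefactors such as \<open>\<epsilon>\<close> and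
    \<open>\<kappa> * K\<close> are at most 1 and are dropped by \<open>shrink\<close>. A quarter of
    each dissipation term survives.\<close>
  have p1: "X * P \<le> \<mu> / 8 * X\<^sup>2 + 2 / \<mu> * P\<^sup>2"
    using young[of "\<mu> / 8" X P] \<mu>(1) by simp
  have p2: "\<epsilon> * (X * Q) \<le> \<mu> / 8 * X\<^sup>2 + 2 / \<mu> * Q\<^sup>2"
    using young[of "\<mu> / 8" X Q] \<mu>(1) shrink[of \<epsilon> "X * Q"] \<epsilon> nn by simp
  have p3: "Y * Q \<le> \<epsilon> / 12 * Y\<^sup>2 + 3 / \<epsilon> * Q\<^sup>2"
    using young[of "\<epsilon> / 12" Y Q] \<epsilon>(1) by simp
  have p4: "\<epsilon> * (P * Y) \<le> \<epsilon> / 12 * Y\<^sup>2 + 3 / \<epsilon> * P\<^sup>2"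
    using young[of "\<epsilon> / 12" Y P] \<epsilon> shrink[of \<epsilon> "P * Y"] nn by (simp add: mult.commute)
  have p5: "\<kappa> * (Y * (K * R)) \<le> \<epsilon> / 12 * Y\<^sup>2 + 3 / \<epsilon> * R\<^sup>2"
    using young[of "\<epsilon> / 12" Y R] \<epsilon>(1) shrink[of "\<kappa> * K" "Y * R"] \<kappa>K nn by (simp add: mult_ac)
  have p6: "W * (R / e) \<le> \<kappa> / 8 * W\<^sup>2 + 2 / (\<kappa> * e\<^sup>2) * R\<^sup>2"
    using young[of "\<kappa> / 8" W "R / e"] \<kappa>0 by (simp add: power_divide mult_ac)
  have p7: "\<kappa> * (Q * W) \<le> \<kappa> / 8 * W\<^sup>2 + 2 / \<kappa> * Q\<^sup>2"
    using young[of "\<kappa> / 8" W Q] \<kappa>0 shrink[of \<kappa> "Q * W"] \<kappa>\<epsilon> \<epsilon> nn by (simp add: mult.commute)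

  \<comment> \<open>As \<open>K\<close> is at least 1, the charges on \<open>X\<close> sum to at
    most \<open>37 * K\<^sup>2 * \<epsilon>\<close>; the 74 is twice this 37.\<close>
  have xcoef: "\<epsilon> * (4 * K\<^sup>2 * X\<^sup>2) + 32 * K\<^sup>2 * \<epsilon> * X\<^sup>2 + \<epsilon> * X\<^sup>2 \<le> \<mu> / 2 * X\<^sup>2"
  proof -
    have "4 * K\<^sup>2 * \<epsilon> + 32 * K\<^sup>2 * \<epsilon> + \<epsilon> \<le> \<mu> / 2"
    proof -
      have "\<epsilon> \<le> K\<^sup>2 * \<epsilon>" using K2(1) \<epsilon>(1) by simp
      then show ?thesis using \<epsilon>(3) by linarith
    qed
    from mult_right_mono[OF this, of "X\<^sup>2"] show ?thesis by (simp add: algebra_simps)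
  qed
  define S where "S = P\<^sup>2 + Q\<^sup>2 + R\<^sup>2"
  have Pn: "0 \<le> P\<^sup>2" "0 \<le> Q\<^sup>2" "0 \<le> R\<^sup>2" by simp_all
  have S: "2 / \<mu> * (P\<^sup>2 + Q\<^sup>2) \<le> 2 / \<mu> * S"
    "3 / \<epsilon> * (Q\<^sup>2 + P\<^sup>2 + R\<^sup>2) = 3 / \<epsilon> * S"
    "2 / \<kappa> * Q\<^sup>2 \<le> 2 / \<kappa> * S"
    "2 / (\<kappa> * e\<^sup>2) * R\<^sup>2 \<le> 2 / (\<kappa> * e\<^sup>2) * S"
    using \<mu>(1) \<kappa>0 e(1) Pn by (auto simp: S_def intro!: divide_right_mono)
  have "saddle_rate L \<epsilon> \<kappa> x y z (- G - y + p) (- L y - L z + x + q) (L y + r)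
     \<le> - (\<mu> * X\<^sup>2) + X * P + Y * Q + Z * R
       + \<epsilon> * (K * X * Y - Y\<^sup>2 + P * Y + X * (K * Y) + X * W + X\<^sup>2 + X * Q)
       + \<kappa> * (K * Y * W - W\<^sup>2 + X * W + Q * W + Y * (K * (K * Y)) + Y * (K * R))"
    unfolding rate
    using mult_left_mono[OF A, of \<epsilon>] mult_left_mono[OF B, of \<kappa>] \<epsilon>(1) \<kappa>0 \<mu>(2) psd[of y]
      cs(1)[of x p] cs(1)[of y q] cs(1)[of z r]
    unfolding n[symmetric] by linarith
  also have "\<dots> = - (\<mu> * X\<^sup>2) - \<epsilon> * Y\<^sup>2 - \<kappa> * W\<^sup>2 + \<epsilon> * X\<^sup>2
       + \<epsilon> * (K * X * Y + X * (K * Y)) + (\<epsilon> + \<kappa>) * (X * W) + \<kappa> * (K * Y * W + Y * (K * (K * Y)))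
       + X * P + \<epsilon> * (X * Q) + Y * Q + \<epsilon> * (P * Y) + \<kappa> * (Y * (K * R)) + Z * R + \<kappa> * (Q * W)"
    by (simp add: algebra_simps)
  also have "\<dots> \<le> - (\<mu> / 4 * X\<^sup>2) - \<epsilon> / 4 * Y\<^sup>2 - \<kappa> / 4 * W\<^sup>2
       + (2 / \<mu> * S + 3 / \<epsilon> * S + 2 / \<kappa> * S + 2 / (\<kappa> * e\<^sup>2) * S)"
    using y1 y2 y3 p1 p2 p3 p4 p5 p6 p7 ZR xcoef S
    by (simp only: distrib_left mult_2)
  also have "\<dots> \<le> - min (\<mu> / 4) (min (\<epsilon> / 4) (\<kappa> * e\<^sup>2 / 4)) * (X\<^sup>2 + Y\<^sup>2 + Z\<^sup>2)
       + (2 / \<mu> + 3 / \<epsilon> + 2 / \<kappa> + 2 / (\<kappa> * e\<^sup>2)) * S"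
  proof -
    let ?m = "min (\<mu> / 4) (min (\<epsilon> / 4) (\<kappa> * e\<^sup>2 / 4))"
    \<comment> \<open>Coercivity again, now turning the surviving dissipation of \<open>W\<close>
      into decay of \<open>Z\<close>.\<close>
    have "(e * Z)\<^sup>2 \<le> W\<^sup>2" using e nn by (intro power_mono) (auto simp: n)
    then have "\<kappa> * e\<^sup>2 / 4 * Z\<^sup>2 \<le> \<kappa> / 4 * W\<^sup>2"
      using mult_left_mono[of "(e * Z)\<^sup>2" "W\<^sup>2" "\<kappa> / 4"] \<kappa>0 by (simp add: power_mult_distrib)
    moreover have "?m * X\<^sup>2 \<le> \<mu> / 4 * X\<^sup>2" by (intro mult_right_mono) auto
    moreover have "?m * Y\<^sup>2 \<le> \<epsilon> / 4 * Y\<^sup>2" by (intro mult_right_mono) auto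
    moreover have "?m * Z\<^sup>2 \<le> \<kappa> * e\<^sup>2 / 4 * Z\<^sup>2" by (intro mult_right_mono) auto
    ultimately show ?thesis
      by (simp only: distrib_left distrib_right minus_mult_left[symmetric])
  qed
  finally show ?thesis by (simp only: n S_def)
qed

text \<open>The energy decays linearly up to a forcing of order \<open>\<rho>\<^sup>2\<close>. The
  constant \<open>c\<close> precedes the trajectory and \<open>\<rho>\<close>, so it cannot depend
  on the observer gain. Coercivity of \<open>L\<close> is asked only along \<open>z\<close>, since a
  Laplacian is singular on the whole space.\<close>

lemma saddle_input_to_state:
  fixes L :: "'v::real_inner \<Rightarrow> 'v"
  assumes L: "bounded_linear L" and sym: "\<And>u v. L u \<bullet> v = u \<bullet> L v" and psd: "\<And>u. 0 \<le> u \<bullet> L u"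
    and e: "e > 0" and \<mu>: "\<mu> > 0"
  obtains c where "c > 0"
    and "\<And>x y z G p q r \<rho> T. \<rho> > 0 \<Longrightarrow>
       (\<And>t. t \<ge> T \<Longrightarrow> (x has_vector_derivative - G t - y t + p t) (at t)) \<Longrightarrow>
       (\<And>t. t \<ge> T \<Longrightarrow> (y has_vector_derivative - L (y t) - L (z t) + x t + q t) (at t)) \<Longrightarrow>
       (\<And>t. t \<ge> T \<Longrightarrow> (z has_vector_derivative L (y t) + r t) (at t)) \<Longrightarrow>
       (\<And>t. \<mu> * (norm (x t))\<^sup>2 \<le> x t \<bullet> G t) \<Longrightarrow>
       (\<And>t. norm (G t) \<le> l * norm (x t)) \<Longrightarrow>
       (\<And>t. e * norm (z t) \<le> norm (L (z t))) \<Longrightarrow>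
       (\<And>t. t \<ge> T \<Longrightarrow> norm (p t) \<le> \<rho>) \<Longrightarrow> (\<And>t. t \<ge> T \<Longrightarrow> norm (q t) \<le> \<rho>) \<Longrightarrow>
       (\<And>t. t \<ge> T \<Longrightarrow> norm (r t) \<le> \<rho>) \<Longrightarrow>
       eventually (\<lambda>t. norm (x t) \<le> c * \<rho>) at_top"
proof -
  interpret bounded_linear L by fact
  obtain K0 where K0: "\<And>u. norm (L u) \<le> norm u * K0" using bounded by blast
  \<comment> \<open>One constant bounds both \<open>L\<close> and the growth of \<open>G\<close>,
    and being at least 1 makes its powers comparable.\<close>
  define K where "K = max 1 (max K0 l)"
  have K: "1 \<le> K" "K0 \<le> K" "l \<le> K" by (auto simp: K_def)
  have LK: "norm (L u) \<le> K * norm u" for u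
    using K0[of u] mult_left_mono[OF K(2), of "norm u"] by (simp add: mult.commute)
  define \<epsilon> where "\<epsilon> = min (1/4) (\<mu> / (74 * K\<^sup>2))"
  define \<kappa> where "\<kappa> = \<epsilon> / (8 * K\<^sup>2)"
  have "K\<^sup>2 > 0" using K by simp
  have \<epsilon>: "0 < \<epsilon>" "\<epsilon> \<le> 1/4" "74 * K\<^sup>2 * \<epsilon> \<le> \<mu>"
  proof -
    have "\<epsilon> \<le> \<mu> / (74 * K\<^sup>2)" by (simp add: \<epsilon>_def)
    then show "74 * K\<^sup>2 * \<epsilon> \<le> \<mu>" using \<open>K\<^sup>2 > 0\<close> by (simp add: pos_le_divide_eq mult.commute)
    show "0 < \<epsilon>" using \<mu> \<open>K\<^sup>2 > 0\<close> by (simp add: \<epsilon>_def)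
    show "\<epsilon> \<le> 1/4" by (simp add: \<epsilon>_def)
  qed
  have \<kappa>: "8 * K\<^sup>2 * \<kappa> = \<epsilon>" "0 < \<kappa>" using \<open>K\<^sup>2 > 0\<close> \<epsilon> by (auto simp: \<kappa>_def)
  have "K \<le> K\<^sup>2" using K by (simp add: power2_eq_square)
  then have "\<kappa> * K \<le> \<kappa> * K\<^sup>2" using \<kappa>(2) by simp
  moreover have "\<kappa> * K\<^sup>2 = \<epsilon> / 8" using \<kappa>(1) by (simp add: mult.commute mult.left_commute)
  ultimately have \<kappa>K: "\<kappa> * K \<le> 1/4" using \<epsilon>(2) by linarith
  define \<alpha> where "\<alpha> = min (\<mu> / 4) (min (\<epsilon> / 4) (\<kappa> * e\<^sup>2 / 4))"
  define \<beta> where "\<beta> = 2 / \<mu> + 3 / \<epsilon> + 2 / \<kappa> + 2 / (\<kappa> * e\<^sup>2)"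
  have \<alpha>: "\<alpha> > 0" using \<mu> \<epsilon> \<kappa> e by (simp add: \<alpha>_def)
  have \<beta>: "\<beta> > 0" unfolding \<beta>_def using \<mu> \<epsilon> \<kappa> e by (intro add_pos_pos) auto
  \<comment> \<open>Three disturbances give the level
    \<open>3 * \<beta> * \<rho>\<^sup>2 / \<alpha>\<close>, doubled for strictness; the energy lower
    bound contributes the remaining factor 4.\<close>
  define c where "c = sqrt (24 * \<beta> / \<alpha>)"
  show ?thesis
  proof (rule that)
    show "c > 0" using \<alpha> \<beta> by (simp add: c_def)
    fix x y z G p q r and \<rho> T :: real
    assume \<rho>: "\<rho> > 0"
      and x: "\<And>t. t \<ge> T \<Longrightarrow> (x has_vector_derivative - G t - y t + p t) (at t)"
      and y: "\<And>t. t \<ge> T \<Longrightarrow> (y has_vector_derivative - L (y t) - L (z t) + x t + q t) (at t)"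
      and z: "\<And>t. t \<ge> T \<Longrightarrow> (z has_vector_derivative L (y t) + r t) (at t)"
      and mono: "\<And>t. \<mu> * (norm (x t))\<^sup>2 \<le> x t \<bullet> G t"
      and lip: "\<And>t. norm (G t) \<le> l * norm (x t)"
      and ez: "\<And>t. e * norm (z t) \<le> norm (L (z t))"
      and pqr: "\<And>t. t \<ge> T \<Longrightarrow> norm (p t) \<le> \<rho>" "\<And>t. t \<ge> T \<Longrightarrow> norm (q t) \<le> \<rho>"
        "\<And>t. t \<ge> T \<Longrightarrow> norm (r t) \<le> \<rho>"
    define E where "E t = saddle_energy L \<epsilon> \<kappa> (x t) (y t) (z t)" for t
    define N where "N t = (norm (x t))\<^sup>2 + (norm (y t))\<^sup>2 + (norm (z t))\<^sup>2" for t
    define D where "D t = saddle_rate L \<epsilon> \<kappa> (x t) (y t) (z t) (- G t - y t + p t)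
      (- L (y t) - L (z t) + x t + q t) (L (y t) + r t)" for t
    have EN: "N t / 4 \<le> E t" "E t \<le> N t" for t
      unfolding N_def E_def using \<epsilon> \<kappa>(2) \<kappa>K LK by (intro saddle_energy_bounds[of L K]; simp)+
    have "eventually (\<lambda>t. E t \<le> 6 * \<beta> * \<rho>\<^sup>2 / \<alpha>) at_top"
    proof (rule eventually_le_of_linear_decay)
      show "\<alpha> > 0" by fact
      show "3 * \<beta> * \<rho>\<^sup>2 / \<alpha> < 6 * \<beta> * \<rho>\<^sup>2 / \<alpha>" using \<alpha> \<beta> \<rho> by (intro divide_strict_right_mono) auto
      fix t assume t: "t \<ge> T"
      show "(E has_real_derivative D t) (at t)"
        unfolding E_def D_def
        by (rule saddle_energy_has_derivative[OF L x[OF t] y[OF t] z[OF t]])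
      have lip': "norm (G t) \<le> K * norm (x t)"
        using lip[of t] mult_right_mono[OF K(3), of "norm (x t)"] by simp
      have "D t \<le> - \<alpha> * N t + \<beta> * ((norm (p t))\<^sup>2 + (norm (q t))\<^sup>2 + (norm (r t))\<^sup>2)"
        unfolding D_def \<alpha>_def \<beta>_def N_def
        by (rule saddle_rate_le[OF L sym psd K(1) LK e ez \<mu> mono lip' \<epsilon> \<kappa>(1)])
      also have "\<dots> \<le> - \<alpha> * E t + \<beta> * (3 * \<rho>\<^sup>2)"
      proof (rule add_mono)
        show "- \<alpha> * N t \<le> - \<alpha> * E t" using EN(2)[of t] \<alpha> by simp
        have "(norm (p t))\<^sup>2 \<le> \<rho>\<^sup>2" "(norm (q t))\<^sup>2 \<le> \<rho>\<^sup>2" "(norm (r t))\<^sup>2 \<le> \<rho>\<^sup>2"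
          using pqr[OF t] by (auto intro: power_mono)
        then show "\<beta> * ((norm (p t))\<^sup>2 + (norm (q t))\<^sup>2 + (norm (r t))\<^sup>2) \<le> \<beta> * (3 * \<rho>\<^sup>2)"
          using \<beta> by (intro mult_left_mono) auto
      qed
      finally show "D t \<le> - \<alpha> * E t + 3 * \<beta> * \<rho>\<^sup>2" by (simp add: mult_ac)
    qed
    then show "eventually (\<lambda>t. norm (x t) \<le> c * \<rho>) at_top"
    proof eventually_elim
      case (elim t)
      have "(norm (x t))\<^sup>2 \<le> N t" by (simp add: N_def)
      also have "\<dots> \<le> 24 * \<beta> / \<alpha> * \<rho>\<^sup>2" using EN(1)[of t] elim by simp
      also have "\<dots> = (c * \<rho>)\<^sup>2" using \<alpha> \<beta> by (simp add: c_def power_mult_distrib)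
      finally show "norm (x t) \<le> c * \<rho>"
        using \<open>c > 0\<close> \<rho> by (intro power2_le_imp_le[of "norm (x t)"]) auto
    qed
  qed
qed

subsection \<open>Observer error\<close>

text \<open>For the scaled error, dissipation of order \<open>w\<close> times its square meets a
  forcing of order \<open>B / w\<close> times its norm, so the error settles at order
  \<open>B / w\<^sup>2\<close>; unscaling the second block costs one factor \<open>w\<close>. The
  constant \<open>c\<close> involves only the data of the observer condition.\<close>

lemma observer_error_bound:
  assumes "observer_condition h1 h2"
  obtains c where "c > 0"
    and "\<And>w B T \<zeta> \<delta> \<kappa>'. w > 0 \<Longrightarrow> B > 0 \<Longrightarrow>
       (\<And>t. t \<ge> T \<Longrightarrow> (\<zeta> has_vector_derivative \<delta> t - w *\<^sub>R h1 (\<zeta> t)) (at t)) \<Longrightarrow>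
       (\<And>t. t \<ge> T \<Longrightarrow> (\<delta> has_vector_derivative \<kappa>' t - w\<^sup>2 *\<^sub>R h2 (\<zeta> t)) (at t)) \<Longrightarrow>
       (\<And>t. t \<ge> T \<Longrightarrow> norm (\<kappa>' t) \<le> B) \<Longrightarrow>
       eventually (\<lambda>t. norm (\<delta> t) \<le> c * B / w) at_top"
proof -
  from assms[unfolded observer_condition_def]
  obtain l1 l2 l3 l4 l5 V W gradV gradW where
    l: "l1 > 0" "l2 > 0" "l3 > 0" "l4 > 0" "l5 > 0"
    and "positive_definite V" and C1: "C1_with_gradient V gradV"
    and "positive_definite W" "C1_with_gradient W gradW"
    and H: "\<forall>\<eta>1 \<eta>2.
       l1 * (norm (\<eta>1, \<eta>2))\<^sup>2 \<le> V (\<eta>1, \<eta>2) \<and> V (\<eta>1, \<eta>2) \<le> l2 * (norm (\<eta>1, \<eta>2))\<^sup>2 \<and>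
       l3 * (norm (\<eta>1, \<eta>2))\<^sup>2 \<le> W (\<eta>1, \<eta>2) \<and> W (\<eta>1, \<eta>2) \<le> l4 * (norm (\<eta>1, \<eta>2))\<^sup>2 \<and>
       fst (gradV (\<eta>1, \<eta>2)) \<bullet> (\<eta>2 - h1 \<eta>1) - snd (gradV (\<eta>1, \<eta>2)) \<bullet> h2 \<eta>1
         \<le> - W (\<eta>1, \<eta>2) \<and>
       norm (snd (gradV (\<eta>1, \<eta>2))) \<le> l5 * norm (\<eta>1, \<eta>2)"
    by (elim exE conjE) (rule that; assumption)
  have grad: "GDERIV V \<eta> :> gradV \<eta>" for \<eta>
    using C1 unfolding C1_with_gradient_def by blast
  have V: "l1 * (norm \<eta>)\<^sup>2 \<le> V \<eta>" "V \<eta> \<le> l2 * (norm \<eta>)\<^sup>2"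
    and W: "l3 * (norm \<eta>)\<^sup>2 \<le> W \<eta>"
    and gradV: "norm (snd (gradV \<eta>)) \<le> l5 * norm \<eta>" for \<eta>
    using H by (cases \<eta>; blast)+
  have diss: "fst (gradV (\<eta>1, \<eta>2)) \<bullet> (\<eta>2 - h1 \<eta>1) - snd (gradV (\<eta>1, \<eta>2)) \<bullet> h2 \<eta>1
      \<le> - W (\<eta>1, \<eta>2)" for \<eta>1 \<eta>2
    using H by blast
  \<comment> \<open>Obtained from \<open>w\<^sup>2 * (2 * (\<beta> / \<alpha>) / l1)\<close>, with
    \<open>\<alpha>\<close> and \<open>\<beta>\<close> as below, by extracting
    \<open>(B / w)\<^sup>2\<close>.\<close>
  define c where "c = sqrt (2 * l2 * l5\<^sup>2 / (l1 * l3\<^sup>2))"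
  show ?thesis
  proof (rule that)
    show "c > 0" using l by (simp add: c_def)
    fix w B T :: real and \<zeta> \<delta> \<kappa>' :: "real \<Rightarrow> 'a vec3"
    assume w: "w > 0" and B: "B > 0"
      and \<zeta>: "\<And>t. t \<ge> T \<Longrightarrow> (\<zeta> has_vector_derivative \<delta> t - w *\<^sub>R h1 (\<zeta> t)) (at t)"
      and \<delta>: "\<And>t. t \<ge> T \<Longrightarrow> (\<delta> has_vector_derivative \<kappa>' t - w\<^sup>2 *\<^sub>R h2 (\<zeta> t)) (at t)"
      and \<kappa>': "\<And>t. t \<ge> T \<Longrightarrow> norm (\<kappa>' t) \<le> B"
    define \<eta> where "\<eta> t = (\<zeta> t, (1 / w) *\<^sub>R \<delta> t)" for t
    define \<eta>' where "\<eta>' t = (\<delta> t - w *\<^sub>R h1 (\<zeta> t), (1 / w) *\<^sub>R (\<kappa>' t - w\<^sup>2 *\<^sub>R h2 (\<zeta> t)))" for t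
    \<comment> \<open>Half of the dissipation \<open>w * l3\<close> absorbs the forcing, which
      leaves \<open>\<beta>\<close>; the other half, divided by \<open>l2\<close>, becomes the decay
      rate of \<open>V\<close>.\<close>
    define \<alpha> where "\<alpha> = w * l3 / (2 * l2)"
    define \<beta> where "\<beta> = (l5 * B / w)\<^sup>2 / (2 * w * l3)"
    have "\<alpha> > 0" using w l by (simp add: \<alpha>_def)
    have "eventually (\<lambda>t. V (\<eta> t) \<le> 2 * (\<beta> / \<alpha>)) at_top"
    proof (rule eventually_le_of_linear_decay)
      show "\<alpha> > 0" by fact
      have "\<beta> / \<alpha> > 0" using w l B by (simp add: \<alpha>_def \<beta>_def)
      then show "\<beta> / \<alpha> < 2 * (\<beta> / \<alpha>)" by simp
      fix t assume t: "t \<ge> T"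
      have "(\<eta> has_vector_derivative \<eta>' t) (at t)"
        unfolding \<eta>_def[abs_def] \<eta>'_def
        by (intro has_vector_derivative_Pair \<zeta>[OF t]
            bounded_linear.has_vector_derivative[OF bounded_linear_scaleR_right \<delta>[OF t]])
      from has_derivative_compose[OF this[unfolded has_vector_derivative_def] grad[unfolded gderiv_def]]
      show "((\<lambda>t. V (\<eta> t)) has_real_derivative \<eta>' t \<bullet> gradV (\<eta> t)) (at t)"
        by (simp add: has_field_derivative_def mult.commute[of _ "\<eta>' t \<bullet> gradV (\<eta> t)"])
      have sq: "w * (l3 * (norm (\<eta> t))\<^sup>2) \<le> w * W (\<eta> t)" using W w by simp
      \<comment> \<open>Scaling \<open>\<delta>\<close> by \<open>1 / w\<close> reduces the gain
        \<open>w\<^sup>2\<close> to \<open>w\<close>, so both blocks share one factor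
        \<open>w\<close> and the dissipation condition applies at \<open>\<eta> t\<close>.\<close>
      have "\<eta>' t \<bullet> gradV (\<eta> t) = w * (fst (gradV (\<eta> t)) \<bullet> ((1 / w) *\<^sub>R \<delta> t - h1 (\<zeta> t))
          - snd (gradV (\<eta> t)) \<bullet> h2 (\<zeta> t)) + (snd (gradV (\<eta> t)) \<bullet> \<kappa>' t) / w"
        using w by (simp add: \<eta>'_def inner_prod_def inner_diff_left inner_diff_right inner_commute
            power2_eq_square field_simps)
      also have "\<dots> \<le> w * (- W (\<eta> t)) + (snd (gradV (\<eta> t)) \<bullet> \<kappa>' t) / w"
        using diss[of "\<zeta> t" "(1 / w) *\<^sub>R \<delta> t"] w unfolding \<eta>_def by (intro add_right_mono mult_left_mono) auto
      also have "\<dots> \<le> w * (- W (\<eta> t)) + (l5 * norm (\<eta> t)) * B / w"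
      proof -
        have "snd (gradV (\<eta> t)) \<bullet> \<kappa>' t \<le> norm (snd (gradV (\<eta> t))) * norm (\<kappa>' t)"
          by (rule norm_cauchy_schwarz)
        also have "\<dots> \<le> (l5 * norm (\<eta> t)) * B"
          using gradV \<kappa>'[OF t] l by (intro mult_mono) auto
        finally show ?thesis using w by (simp add: divide_right_mono)
      qed
      also have "\<dots> \<le> - (w * l3) * (norm (\<eta> t))\<^sup>2 + norm (\<eta> t) * (l5 * B / w)"
        using sq by (simp add: mult_ac)
      also have "\<dots> \<le> - (w * l3) * (norm (\<eta> t))\<^sup>2 + (w * l3 / 2 * (norm (\<eta> t))\<^sup>2 + \<beta>)"
        using young[of "w * l3 / 2" "norm (\<eta> t)" "l5 * B / w"] w l by (simp add: \<beta>_def mult_ac)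
      also have "\<dots> = - \<alpha> * (l2 * (norm (\<eta> t))\<^sup>2) + \<beta>" using l by (simp add: \<alpha>_def)
      also have "\<dots> \<le> - \<alpha> * V (\<eta> t) + \<beta>"
        using mult_left_mono[OF V(2)[of "\<eta> t"], of \<alpha>] \<open>\<alpha> > 0\<close> by simp
      finally show "\<eta>' t \<bullet> gradV (\<eta> t) \<le> - \<alpha> * V (\<eta> t) + \<beta>" .
    qed
    then show "eventually (\<lambda>t. norm (\<delta> t) \<le> c * B / w) at_top"
    proof eventually_elim
      case (elim t)
      have "norm (\<delta> t) = w * norm ((1 / w) *\<^sub>R \<delta> t)" using w by simp
      also have "\<dots> \<le> w * norm (\<eta> t)"
        using w norm_snd_le[of "(1 / w) *\<^sub>R \<delta> t" "\<zeta> t"] unfolding \<eta>_def by (intro mult_left_mono) auto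
      finally have "(norm (\<delta> t))\<^sup>2 \<le> w\<^sup>2 * (norm (\<eta> t))\<^sup>2"
        using power_mono[of "norm (\<delta> t)" "w * norm (\<eta> t)" 2] by (simp add: power_mult_distrib)
      also have "(norm (\<eta> t))\<^sup>2 \<le> 2 * (\<beta> / \<alpha>) / l1"
        using order_trans[OF V(1)[of "\<eta> t"] elim] l(1) by (simp only: pos_le_divide_eq mult.commute)
      then have "w\<^sup>2 * (norm (\<eta> t))\<^sup>2 \<le> w\<^sup>2 * (2 * (\<beta> / \<alpha>) / l1)" by (intro mult_left_mono) auto
      also have "\<dots> = (c * B / w)\<^sup>2"
        using l w by (simp add: \<alpha>_def \<beta>_def c_def power_mult_distrib power_divide field_simps power2_eq_square)
      finally show "norm (\<delta> t) \<le> c * B / w"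
        using \<open>c > 0\<close> B w by (intro power2_le_imp_le[of "norm (\<delta> t)"]) auto
    qed
  qed
qed

subsection \<open>Graph Laplacian\<close>

definition laplacian :: "('N::finite \<Rightarrow> 'N \<Rightarrow> real) \<Rightarrow> (real^'n)^'N \<Rightarrow> (real^'n)^'N" where
  "laplacian a u = (\<chi> i. disagreement a (($) u) i)"

text \<open>The orthogonal projection onto stacks with vanishing agent sum; it removes the constant
  part, which the Laplacian annihilates.\<close>

definition centered :: "(real^'n)^'N::finite \<Rightarrow> (real^'n)^'N" where
  "centered u = (\<chi> i. u $ i - (1 / real CARD('N)) *\<^sub>R (\<Sum>j\<in>UNIV. u $ j))"

lemma bounded_linear_laplacian: "bounded_linear (laplacian a)"
  unfolding linear_conv_bounded_linear[symmetric]
  by (rule linearI; simp add: vec_eq_iff laplacian_def disagreement_def sum.distrib[symmetric]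
      scaleR_sum_right algebra_simps)

lemma bounded_linear_centered: "bounded_linear (centered :: (real^'n)^'N::finite \<Rightarrow> _)"
  unfolding linear_conv_bounded_linear[symmetric]
  by (rule linearI; simp add: vec_eq_iff centered_def sum.distrib sum_distrib_left[symmetric] algebra_simps)

text \<open>The Dirichlet form of the graph, obtained by averaging the double sum with its copy
  under exchange of \<open>i\<close> and \<open>j\<close>. Symmetry, positivity and the kernel of
  the Laplacian are read off from it.\<close>

lemma inner_laplacian:
  assumes "connected_weights a"
  shows "laplacian a u \<bullet> v = (\<Sum>i\<in>UNIV. \<Sum>j\<in>UNIV. a i j * ((u $ i - u $ j) \<bullet> (v $ i - v $ j))) / 2"
proof -
  have sym: "a i j = a j i" for i j using assms unfolding connected_weights_def by blast
  let ?S = "\<lambda>k. \<Sum>i\<in>UNIV. \<Sum>j\<in>UNIV. a i j * ((u $ i - u $ j) \<bullet> k i j)"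
  have "laplacian a u \<bullet> v = ?S (\<lambda>i j. v $ i)"
    unfolding inner_vec_def[of "laplacian a u"]
    by (simp add: laplacian_def disagreement_def inner_sum_left)
  moreover have "?S (\<lambda>i j. v $ i) = - ?S (\<lambda>i j. v $ j)"
  proof -
    have "?S (\<lambda>i j. v $ i) = (\<Sum>j\<in>UNIV. \<Sum>i\<in>UNIV. a i j * ((u $ i - u $ j) \<bullet> v $ i))"
      by (rule sum.swap)
    also have "\<dots> = - ?S (\<lambda>i j. v $ j)"
      unfolding sum_negf[symmetric]
      by (intro sum.cong refl) (subst sym, simp add: inner_diff_left algebra_simps)
    finally show ?thesis .
  qed
  moreover have "?S (\<lambda>i j. v $ i - v $ j) = ?S (\<lambda>i j. v $ i) - ?S (\<lambda>i j. v $ j)"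
    by (simp add: inner_diff_right right_diff_distrib sum_subtractf)
  ultimately show ?thesis by simp
qed

lemma laplacian_sym:
  assumes "connected_weights a"
  shows "laplacian a u \<bullet> v = u \<bullet> laplacian a v"
  using inner_laplacian[OF assms, of u v] inner_laplacian[OF assms, of v u]
  by (simp add: inner_commute)

lemma laplacian_psd:
  assumes "connected_weights a"
  shows "0 \<le> u \<bullet> laplacian a u"
proof -
  have "0 \<le> a i j" for i j using assms unfolding connected_weights_def by blast
  then have "0 \<le> laplacian a u \<bullet> u"
    unfolding inner_laplacian[OF assms] by (auto intro!: sum_nonneg divide_nonneg_nonneg)
  then show ?thesis by (simp add: inner_commute)
qed

text \<open>The Dirichlet form vanishes, hence so does each of its nonnegative summands. Values
  therefore agree across edges, and along paths by connectedness.\<close>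

lemma laplacian_eq_0_imp_constant:
  assumes "connected_weights a" and "laplacian a u = 0"
  shows "u $ i = u $ j"
proof -
  have nn: "0 \<le> a p q * ((u $ p - u $ q) \<bullet> (u $ p - u $ q))" for p q
    using assms(1) unfolding connected_weights_def by auto
  have "(\<Sum>p\<in>UNIV. \<Sum>q\<in>UNIV. a p q * ((u $ p - u $ q) \<bullet> (u $ p - u $ q))) = 0"
    using inner_laplacian[OF assms(1), of u u] assms(2) by simp
  then have zero: "a p q * ((u $ p - u $ q) \<bullet> (u $ p - u $ q)) = 0" for p q
    using nn by (simp add: sum_nonneg_eq_0_iff sum_nonneg)
  have "(i, j) \<in> {(p, q). a p q > 0}\<^sup>*"
    using assms(1) unfolding connected_weights_def by blast
  then show ?thesis
  proof (induction rule: rtrancl_induct)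
    case (step p q)
    then show ?case using zero[of p q] by simp
  qed simp
qed

lemma laplacian_constant: "laplacian a (\<chi> i. c) = 0"
  by (simp add: laplacian_def disagreement_def vec_eq_iff)

text \<open>Constants lie in the kernel, so by symmetry the range is orthogonal to them.\<close>

lemma sum_laplacian:
  assumes "connected_weights a"
  shows "(\<Sum>i\<in>UNIV. laplacian a u $ i) = 0"
proof -
  have "(\<Sum>i\<in>UNIV. laplacian a u $ i) \<bullet> c = 0" for c
    using laplacian_sym[OF assms, of u "\<chi> i. c"]
    by (simp add: laplacian_constant inner_vec_def[of "laplacian a u"] inner_sum_left)
  from this[of "\<Sum>i\<in>UNIV. laplacian a u $ i"] show ?thesis by simp
qed

lemma laplacian_centered: "laplacian a (centered u) = laplacian a u"
  by (simp add: laplacian_def centered_def disagreement_def)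

lemma centered_laplacian:
  assumes "connected_weights a"
  shows "centered (laplacian a u) = laplacian a u"
  by (simp add: centered_def sum_laplacian[OF assms])

lemma sum_centered:
  fixes u :: "(real^'n)^'N::finite"
  shows "(\<Sum>i\<in>UNIV. centered u $ i) = 0"
  by (simp add: centered_def sum_subtractf sum_constant_scaleR del: sum_component sum_constant)

lemma constant_sum_zero:
  fixes u :: "(real^'n)^'N::finite"
  assumes "\<And>i j. u $ i = u $ j" and "(\<Sum>i\<in>UNIV. u $ i) = 0"
  shows "u = 0"
proof -
  have "u $ i = 0" for i
  proof -
    have "(\<Sum>j\<in>UNIV. u $ j) = (\<Sum>j\<in>(UNIV::'N set). u $ i)" using assms(1) by (intro sum.cong) auto
    then show ?thesis using assms(2) by (simp add: sum_constant_scaleR del: sum_component sum_constant)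
  qed
  then show ?thesis by (simp add: vec_eq_iff)
qed

text \<open>The part \<open>w\<close> of \<open>b\<close> orthogonal to the range lies in the kernel
  by symmetry, so it is constant; its agent sum also vanishes, which forces it to be zero. This
  supplies the equilibrium value of the auxiliary states.\<close>

lemma laplacian_surj_on_sum_zero:
  assumes a: "connected_weights a" and b: "(\<Sum>i\<in>UNIV. b $ i) = 0"
  obtains z where "laplacian a z = b"
proof -
  interpret bounded_linear "laplacian a" by (rule bounded_linear_laplacian)
  have "subspace (range (laplacian a))" by (intro linear_subspace_image linear_axioms) simp
  then have span: "span (range (laplacian a)) = range (laplacian a)" by (simp add: span_eq_iff)
  obtain y w where y: "y \<in> range (laplacian a)" and
    w: "\<And>u. u \<in> range (laplacian a) \<Longrightarrow> orthogonal w u" and b_eq: "b = y + w"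
    using orthogonal_subspace_decomp_exists[of "range (laplacian a)" b] unfolding span by blast
  have "laplacian a w \<bullet> laplacian a w = 0"
    using w[of "laplacian a (laplacian a w)"] laplacian_sym[OF a, of w "laplacian a w"]
    by (simp add: orthogonal_def)
  then have "laplacian a w = 0" by simp
  then have const: "w $ i = w $ j" for i j by (rule laplacian_eq_0_imp_constant[OF a])
  have "(\<Sum>i\<in>UNIV. y $ i) = 0" using y sum_laplacian[OF a] by auto
  then have "(\<Sum>i\<in>UNIV. w $ i) = 0" using b b_eq by (simp add: sum.distrib del: sum_component)
  from constant_sum_zero[OF const this] b_eq y that show ?thesis by auto
qed

text \<open>The kernel meets the zero-sum subspace only in 0, and an injective linear map on a
  finite-dimensional subspace is bounded below: the spectral gap of a connected graph.\<close>

lemma laplacian_coercive: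
  fixes a :: "'N::finite \<Rightarrow> 'N \<Rightarrow> real"
  assumes a: "connected_weights a"
  shows "\<exists>e>0. \<forall>u :: (real^'n)^'N. e * norm (centered u) \<le> norm (laplacian a (centered u))"
proof -
  interpret C: bounded_linear "centered :: (real^'n)^'N \<Rightarrow> _" by (rule bounded_linear_centered)
  have sub: "subspace (range (centered :: (real^'n)^'N \<Rightarrow> _))"
    by (intro linear_subspace_image C.linear_axioms) simp
  have "\<forall>u\<in>range (centered :: (real^'n)^'N \<Rightarrow> _). laplacian a u = 0 \<longrightarrow> u = 0"
    using laplacian_eq_0_imp_constant[OF a] constant_sum_zero sum_centered by blast
  from injective_imp_isometric[OF closed_subspace[OF sub] sub bounded_linear_laplacian this]
  show ?thesis by blast
qed

subsection \<open>Disturbance derivatives\<close>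

lemma derivative_bounded_by_add:
  assumes "derivative_bounded_by M s" "derivative_bounded_by M' s'"
  shows "derivative_bounded_by (M + M') (\<lambda>t. s t + s' t)"
proof -
  from assms obtain d d' where
    "\<forall>t\<ge>0. (s has_vector_derivative d t) (at t within {0..}) \<and> norm (d t) \<le> M"
    "\<forall>t\<ge>0. (s' has_vector_derivative d' t) (at t within {0..}) \<and> norm (d' t) \<le> M'"
    unfolding derivative_bounded_by_def by blast
  then show ?thesis
    unfolding derivative_bounded_by_def
    by (intro exI[of _ "\<lambda>t. d t + d' t"]) (auto intro!: has_vector_derivative_add norm_triangle_mono)
qed

lemma derivative_bounded_by_Pair:
  assumes "derivative_bounded_by M s" "derivative_bounded_by M' s'"
  shows "derivative_bounded_by (M + M') (\<lambda>t. (s t, s' t))"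
proof -
  from assms obtain d d' where
    "\<forall>t\<ge>0. (s has_vector_derivative d t) (at t within {0..}) \<and> norm (d t) \<le> M"
    "\<forall>t\<ge>0. (s' has_vector_derivative d' t) (at t within {0..}) \<and> norm (d' t) \<le> M'"
    unfolding derivative_bounded_by_def by blast
  then show ?thesis
    unfolding derivative_bounded_by_def
    by (intro exI[of _ "\<lambda>t. (d t, d' t)"])
      (auto intro!: has_vector_derivative_Pair order_trans[OF norm_Pair_le] add_mono)
qed

lemma derivative_bounded_by_bounded_linear:
  assumes "bounded_linear F" "derivative_bounded_by M s"
  shows "\<exists>B. derivative_bounded_by B (\<lambda>t. F (s t))"
proof -
  interpret bounded_linear F by fact
  from assms obtain d where
    d: "\<forall>t\<ge>0. (s has_vector_derivative d t) (at t within {0..}) \<and> norm (d t) \<le> M"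
    unfolding derivative_bounded_by_def by blast
  obtain K where K: "0 \<le> K" "\<And>x. norm (F x) \<le> norm x * K" using nonneg_bounded by blast
  have "norm (F (d t)) \<le> M * K" if "t \<ge> 0" for t
    by (rule order_trans[OF K(2)]) (use d that K(1) in \<open>auto intro: mult_right_mono\<close>)
  then have "derivative_bounded_by (M * K) (\<lambda>t. F (s t))"
    using d unfolding derivative_bounded_by_def
    by (intro exI[of _ "\<lambda>t. F (d t)"]) (auto intro!: has_vector_derivative)
  then show ?thesis ..
qed

lemma derivative_bounded_by_sum:
  assumes "finite A" "\<And>i. i \<in> A \<Longrightarrow> derivative_bounded_by (M i) (s i)"
  shows "derivative_bounded_by (sum M A) (\<lambda>t. \<Sum>i\<in>A. s i t)"
  using assms
proof (induction A)
  case empty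
  show ?case unfolding derivative_bounded_by_def by (intro exI[of _ "\<lambda>_. 0"]) auto
next
  case (insert i A)
  then show ?case using derivative_bounded_by_add[of "M i" "s i" "sum M A"] by simp
qed

lemma bounded_with_derivative_imp_derivative_bounded_by:
  assumes "bounded_with_derivative s"
  shows "\<exists>B. derivative_bounded_by B s"
proof -
  from assms obtain s' where s': "\<forall>t\<ge>0. (s has_vector_derivative s' t) (at t within {0..})"
    and "bounded (s' ` {0..})"
    unfolding bounded_with_derivative_def by blast
  then obtain B where "\<forall>t\<ge>0. norm (s' t) \<le> B" unfolding bounded_iff by auto
  with s' show ?thesis unfolding derivative_bounded_by_def by blast
qed

lemma disagreement_derivative_bounded_by:
  fixes s :: "'N::finite \<Rightarrow> real \<Rightarrow> real^'n"
  assumes "\<And>i. bounded_with_derivative (s i)"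
  shows "\<exists>B. derivative_bounded_by B (\<lambda>t. disagreement a (\<lambda>j. s j t) i)"
proof -
  have "\<exists>B. derivative_bounded_by B (\<lambda>t. a i j *\<^sub>R (s i t - s j t))" for j
  proof -
    obtain B1 where B1: "derivative_bounded_by B1 (s i)"
      using bounded_with_derivative_imp_derivative_bounded_by[OF assms[of i]] by blast
    obtain B2 where B2: "derivative_bounded_by B2 (s j)"
      using bounded_with_derivative_imp_derivative_bounded_by[OF assms[of j]] by blast
    have "bounded_linear (\<lambda>v. a i j *\<^sub>R (fst v - snd v) :: real^'n)"
      by (intro bounded_linear_intros)
    from derivative_bounded_by_bounded_linear[OF this derivative_bounded_by_Pair[OF B1 B2]]
    show ?thesis by simp
  qed
  then obtain B where "\<And>j. derivative_bounded_by (B j) (\<lambda>t. a i j *\<^sub>R (s i t - s j t))" by metis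
  then show ?thesis
    unfolding disagreement_def
    using derivative_bounded_by_sum[of UNIV B "\<lambda>j t. a i j *\<^sub>R (s i t - s j t)"] by auto
qed

text \<open>The attack signals do not depend on the trajectory and \<open>g\<close> enters only
  through \<open>M\<close>, so \<open>B\<close> can be fixed before \<open>x\<close>, and hence
  independently of the gain.\<close>

lemma disturbance_derivative_bound:
  fixes g :: "'N::finite \<Rightarrow> real^'n \<Rightarrow> real^'n"
  assumes ua: "\<And>i. bounded_with_derivative (ua i)"
    and la: "\<And>i. bounded_with_derivative (la i)"
    and za: "\<And>i. bounded_with_derivative (za i)"
  shows "\<exists>B>0. \<forall>x i. (\<forall>j. derivative_bounded_by M (\<lambda>t. g j (x j t))) \<longrightarrow>
       derivative_bounded_by B (\<lambda>t. disturbance a g (\<lambda>j. ua j t) (\<lambda>j. la j t) (\<lambda>j. za j t) (\<lambda>j. x j t) i)"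
proof -
  have "\<forall>i. \<exists>B. derivative_bounded_by B (ua i)"
    using bounded_with_derivative_imp_derivative_bounded_by[OF ua] by blast
  then obtain U where U: "\<And>i. derivative_bounded_by (U i) (ua i)" by metis
  have "\<forall>i. \<exists>B. derivative_bounded_by B (\<lambda>t. disagreement a (\<lambda>j. la j t) i)"
    by (intro allI disagreement_derivative_bounded_by la)
  then obtain L where L: "\<And>i. derivative_bounded_by (L i) (\<lambda>t. disagreement a (\<lambda>j. la j t) i)"
    by metis
  have "\<forall>i. \<exists>B. derivative_bounded_by B (\<lambda>t. disagreement a (\<lambda>j. za j t) i)"
    by (intro allI disagreement_derivative_bounded_by za)
  then obtain Z where Z: "\<And>i. derivative_bounded_by (Z i) (\<lambda>t. disagreement a (\<lambda>j. za j t) i)"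
    by metis
  have neg: "\<exists>B. derivative_bounded_by B
      (\<lambda>t. - disagreement a (\<lambda>j. la j t) i - disagreement a (\<lambda>j. za j t) i)" for i
  proof -
    have "bounded_linear (\<lambda>v. - fst v - snd v :: real^'n)"
      by (intro bounded_linear_intros bounded_linear_minus)
    from derivative_bounded_by_bounded_linear[OF this derivative_bounded_by_Pair[OF L[of i] Z[of i]]]
    show ?thesis by simp
  qed
  then obtain H where H: "\<And>i. derivative_bounded_by (H i)
      (\<lambda>t. - disagreement a (\<lambda>j. la j t) i - disagreement a (\<lambda>j. za j t) i)" by metis
  define b where "b i = U i + M + (H i + L i)" for i
  \<comment> \<open>The absolute values make the sum dominate every \<open>b i\<close>, whatever the
    signs; the added 1 ensures positivity.\<close>
  define B where "B = (\<Sum>i\<in>UNIV. \<bar>b i\<bar>) + 1"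
  show ?thesis
  proof (intro exI[of _ B] conjI allI impI)
    show "B > 0" unfolding B_def by (intro add_nonneg_pos sum_nonneg) auto
    fix x :: "'N \<Rightarrow> real \<Rightarrow> real^'n" and i
    assume "\<forall>j. derivative_bounded_by M (\<lambda>t. g j (x j t))"
    then have g: "derivative_bounded_by M (\<lambda>t. g i (x i t))" for i by blast
    have "derivative_bounded_by (b i)
      (\<lambda>t. disturbance a g (\<lambda>j. ua j t) (\<lambda>j. la j t) (\<lambda>j. za j t) (\<lambda>j. x j t) i)"
      unfolding disturbance_def b_def
      by (intro derivative_bounded_by_Pair derivative_bounded_by_add U g H L)
    then obtain k' where "\<forall>t\<ge>0. ((\<lambda>t. disturbance a g (\<lambda>j. ua j t) (\<lambda>j. la j t) (\<lambda>j. za j t)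
        (\<lambda>j. x j t) i) has_vector_derivative k' t) (at t within {0..}) \<and> norm (k' t) \<le> b i"
      unfolding derivative_bounded_by_def by blast
    moreover have "b i \<le> B"
      using member_le_sum[of i UNIV "\<lambda>i. \<bar>b i\<bar>"] by (simp add: B_def)
    ultimately show "derivative_bounded_by B
      (\<lambda>t. disturbance a g (\<lambda>j. ua j t) (\<lambda>j. la j t) (\<lambda>j. za j t) (\<lambda>j. x j t) i)"
      unfolding derivative_bounded_by_def by (intro exI[of _ k']) force
  qed
qed

lemma has_vector_derivative_vec_lambda:
  fixes s :: "'N::finite \<Rightarrow> real \<Rightarrow> 'b::euclidean_space"
  assumes "\<And>i. (s i has_vector_derivative s' i) F"
  shows "((\<lambda>t. \<chi> i. s i t) has_vector_derivative (\<chi> i. s' i)) F"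
proof -
  have sum_axis: "(\<chi> i. v i) = (\<Sum>i\<in>UNIV. axis i (v i))" for v :: "'N \<Rightarrow> 'b"
    by (simp add: vec_eq_iff axis_def)
  have "bounded_linear (axis i :: 'b \<Rightarrow> 'b^'N)" for i :: 'N
    unfolding linear_conv_bounded_linear[symmetric]
    by (rule linearI) (auto simp: axis_def vec_eq_iff)
  then show ?thesis
    unfolding sum_axis
    by (intro has_vector_derivative_sum bounded_linear.has_vector_derivative[OF _ assms])
qed

lemma norm_vec_lambda_le:
  fixes v :: "'N::finite \<Rightarrow> 'b::real_normed_vector"
  assumes "\<And>i. norm (v i) \<le> b"
  shows "norm (\<chi> i. v i) \<le> real CARD('N) * b"
proof -
  have "norm (\<chi> i. v i) \<le> (\<Sum>i\<in>UNIV. norm (v i))"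
    using L2_set_le_sum[of UNIV "\<lambda>i. norm (v i)"] by (simp add: norm_vec_def)
  also have "\<dots> \<le> real CARD('N) * b" using assms sum_bounded_above[of UNIV "\<lambda>i. norm (v i)" b] by simp
  finally show ?thesis .
qed

subsection \<open>Closed loop\<close>

theorem theorem3:
  fixes f :: "'N::finite \<Rightarrow> real^'n \<Rightarrow> real"
    and gradf g :: "'N \<Rightarrow> real^'n \<Rightarrow> real^'n"
    and l :: real
    and d :: "'N \<Rightarrow> real^'n"
    and Xopt :: "(real^'n)^'N"
    and a :: "'N \<Rightarrow> 'N \<Rightarrow> real"
    and ua la za :: "'N \<Rightarrow> real \<Rightarrow> real^'n"
    and h1 h2 :: "'n vec3 \<Rightarrow> 'n vec3"
    and M :: real
  assumes "connected_weights a"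
    and "\<And>i. C1_with_gradient (f i) (gradf i)"
    and "\<And>i. strongly_convex (f i)"
    and "\<And>i. l-lipschitz_on UNIV (gradf i)"
    and "optimal_allocation f d Xopt"
    and "\<And>i. bounded_with_derivative (ua i)"
    and "\<And>i. bounded_with_derivative (la i)"
    and "\<And>i. bounded_with_derivative (za i)"
    and "observer_condition h1 h2"
  shows "\<exists>C>0. \<exists>wbar>0. \<forall>w0\<ge>wbar. \<forall>gam gamh kaph.
           closed_loop_solution a gradf d g ua la za h1 h2 w0 (w0\<^sup>2) gam gamh kaph \<and>
           (\<forall>i. derivative_bounded_by M (\<lambda>t. g i (block1 (gam i t)))) \<longrightarrow>
           Limsup at_top (\<lambda>t. ereal (norm ((\<chi> i. block1 (gam i t)) - Xopt))) \<le> ereal (C / w0)"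
proof -
  note conn = assms(1)
  have grad: "GDERIV (f i) x :> gradf i x" for i x
    using assms(2) unfolding C1_with_gradient_def by blast

  have "\<exists>\<mu>>0. \<forall>x y. \<mu> * (norm (x - y))\<^sup>2 \<le> (gradf i x - gradf i y) \<bullet> (x - y)" for i
    using strongly_convex_strongly_monotone[OF assms(3)[of i] grad] by metis
  then obtain m where m: "\<And>i. m i > 0"
    "\<And>i x y. m i * (norm (x - y))\<^sup>2 \<le> (gradf i x - gradf i y) \<bullet> (x - y)" by metis
  define \<mu> where "\<mu> = Min (range m)"
  have \<mu>: "\<mu> > 0" using m(1) by (simp add: \<mu>_def)
  have mono: "\<mu> * (norm (x - y))\<^sup>2 \<le> (gradf i x - gradf i y) \<bullet> (x - y)" for i x y
  proof -
    have "\<mu> \<le> m i" by (simp add: \<mu>_def)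
    then have "\<mu> * (norm (x - y))\<^sup>2 \<le> m i * (norm (x - y))\<^sup>2" by (intro mult_right_mono) auto
    then show ?thesis using m(2)[where i=i and x=x and y=y] by linarith
  qed

  \<comment> \<open>Equilibrium of the multiplier equation; it is solvable because feasibility makes
    the right side sum to zero. Together with \<open>Xopt\<close> and the \<open>\<Lambda>\<close>
    below it forms the saddle point.\<close>
  obtain zs where zs: "laplacian a zs = Xopt - (\<chi> i. d i)"
  proof (rule laplacian_surj_on_sum_zero[OF conn])
    show "(\<Sum>i\<in>UNIV. (Xopt - (\<chi> i. d i)) $ i) = 0"
      using assms(5) by (simp add: optimal_allocation_def sum_subtractf del: sum_component)
  qed
  define \<Lambda> where "\<Lambda> = (\<chi> i. - gradf i (Xopt $ i))"
  \<comment> \<open>Here \<open>undefined\<close> serves as an arbitrary fixed agent: all gradients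
    agree at the optimum, so \<open>\<Lambda>\<close> is a constant stack.\<close>
  have "\<Lambda> = (\<chi> i. - gradf undefined (Xopt $ undefined))"
    unfolding \<Lambda>_def
    by (intro arg_cong[where f=vec_lambda] ext arg_cong[where f=uminus]
        optimal_allocation_gradients_eq[OF assms(5) grad])
  then have L\<Lambda>: "laplacian a \<Lambda> = 0" by (simp only: laplacian_constant)

  from laplacian_coercive[OF conn, where ?'n='n] obtain e where e: "e > 0"
    "\<forall>u :: (real^'n)^'N. e * norm (centered u) \<le> norm (laplacian a (centered u))"
    by (elim exE conjE) (rule that)
  from disturbance_derivative_bound[where ua=ua and la=la and za=za and M=M and g=g and a=a, OF assms(6-8)] obtain B where B: "B > 0"
    "\<forall>x i. (\<forall>j. derivative_bounded_by M (\<lambda>t. g j (x j t))) \<longrightarrow>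
       derivative_bounded_by B (\<lambda>t. disturbance a g (\<lambda>j. ua j t) (\<lambda>j. la j t) (\<lambda>j. za j t) (\<lambda>j. x j t) i)"
    by (elim exE conjE) (rule that)
  from bounded_linear.pos_bounded[OF bounded_linear_centered]
  obtain K where K: "K > 0" "\<forall>u :: (real^'n)^'N. norm (centered u) \<le> norm u * K"
    by (elim exE conjE) (rule that)
  show ?thesis
  \<comment> \<open>The constants \<open>c1\<close> and, below, \<open>c2\<close> are fixed before
    any gain or solution is considered, which makes the final constant independent of
    \<open>w0\<close>.\<close>
  proof (rule saddle_input_to_state[where L="laplacian a :: (real^'n)^'N \<Rightarrow> _" and l=l,
        OF bounded_linear_laplacian laplacian_sym[OF conn] laplacian_psd[OF conn] e(1) \<mu>], goal_cases)
    case (1 c1)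
    note c1 = 1(1) and iss = 1(2)
    show ?thesis
    proof (rule observer_error_bound[OF assms(9)], goal_cases)
      case (1 c2)
      note c2 = 1(1) and obs = 1(2)
      \<comment> \<open>Stacking the agents costs a factor \<open>CARD('N)\<close> and centering the
        third block a factor \<open>K\<close>; \<open>1 + K\<close> covers the centered and the
        uncentered blocks at once.\<close>
      define b where "b = (1 + K) * real CARD('N) * c2 * B"
      have b: "b > 0" using K c2 B by (simp add: b_def)

      have main: "Limsup at_top (\<lambda>t. ereal (norm ((\<chi> i. block1 (gam i t)) - Xopt))) \<le> ereal (c1 * b / w)"
        if w: "w \<ge> 1" and sol: "closed_loop_solution a gradf d g ua la za h1 h2 w (w\<^sup>2) gam gamh kaph"
          and gM: "\<And>i. derivative_bounded_by M (\<lambda>t. g i (block1 (gam i t)))" for w gam gamh kaph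
      proof -
        define kap where "kap i t = disturbance a g (\<lambda>j. ua j t) (\<lambda>j. la j t) (\<lambda>j. za j t)
                        (\<lambda>j. block1 (gam j t)) i" for i t
        define u where "u i t = observer_input a gradf d (\<lambda>j. block1 (gam j t)) (\<lambda>j. block2 (gam j t))
                        (\<lambda>j. block3 (gam j t)) (\<lambda>j. kaph j t) i" for i t
        define \<delta> where "\<delta> i t = kap i t - kaph i t" for i t
        \<comment> \<open>The closed loop provides one-sided derivatives at time 0. Starting at time
          1 gives two-sided ones and does not affect the limit superior.\<close>
        have at: "at t within {0..} = at t" if "t \<ge> 1" for t :: real
          using that by (intro at_within_interior) simp
        have gam: "(gam i has_vector_derivative kap i t + u i t) (at t)"
          and gamh: "(gamh i has_vector_derivative kaph i t + u i t + w *\<^sub>R h1 (gam i t - gamh i t)) (at t)"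
          and kaph: "(kaph i has_vector_derivative w\<^sup>2 *\<^sub>R h2 (gam i t - gamh i t)) (at t)"
          if "t \<ge> 1" for i t
          using sol that unfolding closed_loop_solution_def Let_def kap_def u_def at[OF that, symmetric]
          by auto
        have "eventually (\<lambda>t. norm (\<delta> i t) \<le> c2 * B / w) at_top" for i
        proof -
          obtain kap' where kap': "\<And>t. t \<ge> 0 \<Longrightarrow> (kap i has_vector_derivative kap' t) (at t within {0..})"
            "\<And>t. t \<ge> 0 \<Longrightarrow> norm (kap' t) \<le> B"
            using B(2)[THEN spec, THEN spec, of "\<lambda>i t. block1 (gam i t)" i] gM unfolding derivative_bounded_by_def kap_def[symmetric] by metis
          show ?thesis
          proof (rule obs[where T=1 and \<zeta>="\<lambda>t. gam i t - gamh i t" and \<kappa>'=kap'])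
            show "w > 0" "B > 0" using w B by auto
            fix t :: real assume t: "t \<ge> 1"
            show "norm (kap' t) \<le> B" using kap'(2) t by simp
            have "(kap i has_vector_derivative kap' t) (at t)" using kap'(1)[of t] t at[OF t] by simp
            from has_vector_derivative_diff[OF this kaph[OF t]]
            show "(\<delta> i has_vector_derivative kap' t - w\<^sup>2 *\<^sub>R h2 (gam i t - gamh i t)) (at t)"
              unfolding \<delta>_def[abs_def] .
            from has_vector_derivative_diff[OF gam[OF t] gamh[OF t]]
            show "((\<lambda>t. gam i t - gamh i t) has_vector_derivative
                \<delta> i t - w *\<^sub>R h1 (gam i t - gamh i t)) (at t)"
              by (rule has_vector_derivative_eq_rhs) (simp add: \<delta>_def)
          qed
        qed
        then have "eventually (\<lambda>t. \<forall>i. norm (\<delta> i t) \<le> c2 * B / w) at_top"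
          by (simp add: eventually_all_finite)
        then obtain T0 where T0: "\<And>t i. t \<ge> T0 \<Longrightarrow> norm (\<delta> i t) \<le> c2 * B / w"
          unfolding eventually_at_top_linorder by blast
        define T where "T = max 1 T0"
        have T: "T \<ge> 1" "T \<ge> T0" by (auto simp: T_def)

        define X Y Z :: "real \<Rightarrow> (real^'n)^'N" where XYZ: "X t = (\<chi> i. block1 (gam i t))"
          "Y t = (\<chi> i. block2 (gam i t))" "Z t = (\<chi> i. block3 (gam i t))" for t
        define p q r :: "real \<Rightarrow> (real^'n)^'N" where pqr: "p t = (\<chi> i. block1 (\<delta> i t))"
          "q t = (\<chi> i. block2 (\<delta> i t))" "r t = (\<chi> i. block3 (\<delta> i t))" for t
        define G :: "real \<Rightarrow> (real^'n)^'N" where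
          "G t = (\<chi> i. gradf i (X t $ i) - gradf i (Xopt $ i))" for t
        interpret L: bounded_linear "laplacian a :: (real^'n)^'N \<Rightarrow> _" by (rule bounded_linear_laplacian)
        interpret P: bounded_linear "centered :: (real^'n)^'N \<Rightarrow> _" by (rule bounded_linear_centered)
        have b1: "bounded_linear (\<lambda>v :: 'n vec3. block1 v)" and b2: "bounded_linear (\<lambda>v :: 'n vec3. block2 v)"
          and b3: "bounded_linear (\<lambda>v :: 'n vec3. block3 v)"
          by (intro bounded_linear_intros)+
        have Ly: "laplacian a (Y t - \<Lambda>) = laplacian a (Y t)" for t by (simp add: L.diff L\<Lambda>)
        have Lz: "laplacian a (centered (Z t - zs)) = laplacian a (Z t) - (Xopt - (\<chi> i. d i))" for t
          by (simp add: laplacian_centered L.diff zs)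

        have nth_vec_lambda: "($) (vec_lambda v) = v" for v :: "'N \<Rightarrow> real^'n" by (simp add: fun_eq_iff)
        \<comment> \<open>Subtracting the optimal gradients inside \<open>G\<close> is compensated
          exactly by shifting \<open>Y\<close> by \<open>\<Lambda>\<close>.\<close>
        have X: "(X has_vector_derivative - G t - (Y t - \<Lambda>) + p t) (at t)" if "t \<ge> 1" for t
        proof -
          have "(X has_vector_derivative (\<chi> i. block1 (kap i t + u i t))) (at t)"
            unfolding XYZ(1)[abs_def]
            by (intro has_vector_derivative_vec_lambda bounded_linear.has_vector_derivative[OF b1] gam that)
          then show ?thesis
            by (rule has_vector_derivative_eq_rhs)
              (simp add: vec_eq_iff u_def observer_input_def \<delta>_def G_def XYZ pqr \<Lambda>_def)
        qed
        have Y: "(Y has_vector_derivative - laplacian a (Y t - \<Lambda>) - laplacian a (centered (Z t - zs))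
            + (X t - Xopt) + q t) (at t)" if "t \<ge> 1" for t
        proof -
          have "(Y has_vector_derivative (\<chi> i. block2 (kap i t + u i t))) (at t)"
            unfolding XYZ(2)[abs_def]
            by (intro has_vector_derivative_vec_lambda bounded_linear.has_vector_derivative[OF b2] gam that)
          then show ?thesis
            unfolding Ly Lz
            by (rule has_vector_derivative_eq_rhs)
              (simp add: vec_eq_iff u_def observer_input_def \<delta>_def XYZ pqr laplacian_def nth_vec_lambda)
        qed
        \<comment> \<open>Centering fixes the Laplacian term, whose agent sum is zero, so only
          \<open>r\<close> is altered. The equation for \<open>Y\<close> sees \<open>Z\<close>
          through the Laplacian alone and is unaffected.\<close>
        have Z: "((\<lambda>t. centered (Z t - zs)) has_vector_derivative
            laplacian a (Y t - \<Lambda>) + centered (r t)) (at t)" if "t \<ge> 1" for t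
        proof -
          have "(Z has_vector_derivative (\<chi> i. block3 (kap i t + u i t))) (at t)"
            unfolding XYZ(3)[abs_def]
            by (intro has_vector_derivative_vec_lambda bounded_linear.has_vector_derivative[OF b3] gam that)
          moreover have "(\<chi> i. block3 (kap i t + u i t)) = laplacian a (Y t) + r t"
            by (simp add: vec_eq_iff u_def observer_input_def \<delta>_def XYZ pqr laplacian_def nth_vec_lambda)
          ultimately have "(Z has_vector_derivative laplacian a (Y t) + r t) (at t)" by simp
          then have "((\<lambda>t. Z t - zs) has_vector_derivative laplacian a (Y t) + r t) (at t)"
            using has_vector_derivative_diff_const by blast
          from P.has_vector_derivative[OF this] show ?thesis
            unfolding Ly P.add centered_laplacian[OF conn] .
        qed

        have "eventually (\<lambda>t. norm (X t - Xopt) \<le> c1 * (b / w)) at_top"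
        proof (rule iss[where T=T and G=G and p=p and q=q and r="\<lambda>t. centered (r t)"
              and y="\<lambda>t. Y t - \<Lambda>" and z="\<lambda>t. centered (Z t - zs)"])
          show "b / w > 0" using b w by simp
          fix t :: real
          show "\<mu> * (norm (X t - Xopt))\<^sup>2 \<le> (X t - Xopt) \<bullet> G t"
            using mono unfolding power2_norm_eq_inner
            by (simp add: inner_vec_def[of "X t - Xopt"] G_def sum_distrib_left inner_commute sum_mono)
          have l0: "l \<ge> 0" using lipschitz_on_nonneg[OF assms(4)] .
          have "norm (G t) \<le> norm (l *\<^sub>R (X t - Xopt))"
          proof (rule norm_le_componentwise_cart)
            fix i
            show "norm (G t $ i) \<le> norm ((l *\<^sub>R (X t - Xopt)) $ i)"
              using lipschitz_onD[OF assms(4)[of i], of "X t $ i" "Xopt $ i"] l0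
              by (simp add: G_def dist_norm)
          qed
          then show "norm (G t) \<le> l * norm (X t - Xopt)" using l0 by simp
          show "e * norm (centered (Z t - zs)) \<le> norm (laplacian a (centered (Z t - zs)))" using e(2) by blast
        next
          fix t :: real assume t: "t \<ge> T"
          then have t1: "t \<ge> 1" using T by simp
          have \<rho>: "real CARD('N) * (c2 * B / w) \<le> b / w" "real CARD('N) * (c2 * B / w) * K \<le> b / w"
            using K c2 B w by (auto simp: b_def field_simps)
          have blocks: "norm (block1 v) \<le> norm v" "norm (block2 v) \<le> norm v" "norm (block3 v) \<le> norm v"
            for v :: "'n vec3"
            by (metis norm_fst_le norm_snd_le order_trans prod.collapse)+
          have \<delta>b: "norm (\<delta> i t) \<le> c2 * B / w" for i using T0 t T by simp
          have n: "norm (p t) \<le> real CARD('N) * (c2 * B / w)" "norm (q t) \<le> real CARD('N) * (c2 * B / w)"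
            "norm (r t) \<le> real CARD('N) * (c2 * B / w)"
            unfolding pqr by (intro norm_vec_lambda_le order_trans[OF blocks(1) \<delta>b] order_trans[OF blocks(2) \<delta>b]
                order_trans[OF blocks(3) \<delta>b])+
          show "norm (p t) \<le> b / w" "norm (q t) \<le> b / w" using n \<rho> by auto
          show "norm (centered (r t)) \<le> b / w"
            using spec[OF K(2), of "r t"] mult_right_mono[OF n(3), of K] K(1) \<rho>(2) by simp
          show "((\<lambda>t. X t - Xopt) has_vector_derivative - G t - (Y t - \<Lambda>) + p t) (at t)"
            using X[OF t1] by (simp add: has_vector_derivative_diff_const)
          show "((\<lambda>t. Y t - \<Lambda>) has_vector_derivative - laplacian a (Y t - \<Lambda>)
              - laplacian a (centered (Z t - zs)) + (X t - Xopt) + q t) (at t)"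
            using Y[OF t1] by (simp add: has_vector_derivative_diff_const)
          show "((\<lambda>t. centered (Z t - zs)) has_vector_derivative
              laplacian a (Y t - \<Lambda>) + centered (r t)) (at t)"
            by (rule Z[OF t1])
        qed
        then show ?thesis
          by (intro Limsup_bounded) (simp add: XYZ)
      qed
      show ?thesis
        by (rule exI[of _ "c1 * b"], intro conjI exI[of _ 1])
          (use main c1 b in auto)
    qed
  qed
qed

end
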